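(* The function $s\colon\{\rho_1,\rho_2\}\to P_3(\mathbb{R}P^2)$ defined by $s(\rho_1)=\rho_1\rho_3$ and $s(\rho_2)=\rho_3\rho_2$ extends to a homomorphism $s\colon P_2(\mathbb{R}P^2)\to P_3(\mathbb{R}P^2)$, and gives a splitting of the short exact sequence $$1 \to \pi_1(\mathbb{R}P^2\setminus\{ x_1,x_2 \}) \to P_3(\mathbb{R}P^2) \xrightarrow{p_{\ast}} P_2(\mathbb{R}P^2) \to 1,$$ that is, $p_\ast\circ s=\mathrm{Id}$.
   Context: $P_n(\mathbb{R}P^2)=\pi_1(F_n(\mathbb{R}P^2),(x_1,\ldots,x_n))$ is the $n$th pure braid group of the real projective plane, where $F_n(\mathbb{R}P^2)$ is the space of ordered $n$-tuples of distinct points. The homomorphism $p_\ast$ is induced by the projection $F_3(\mathbb{R}P^2)\to F_2(\mathbb{R}P^2)$, $(x_1,x_2,x_3)\mapsto(x_1,x_2)$. Generators: removing a disc from $\mathbb{R}P^2$ gives a disc with a twisted band attached; $\rho_i$ is the braid represented by the loop based at $x_i$ which goes once round the band while the other points $x_j$, $j\neq i$, stay fixed, and $B_{2,3}=\sigma_2^2$, where $\sigma_1,\sigma_2$ are the images in $B_3(\mathbb{R}P^2)$ of the Artin generators of the braid group of a disc containing the base points. With the paper's conventions, $P_2(\mathbb{R}P^2)\cong Q_8$ has presentation $$\langle \rho_1,\rho_2 \mid \rho_1^2=\rho_2^2,\ \rho_2\rho_1\rho_2^{-1}=\rho_1^{-1}\rangle,$$ and $P_3(\mathbb{R}P^2)$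 has presentation with generators $\rho_1,\rho_2,\rho_3,B_{2,3}$ and relations $$\rho_1B_{2,3}\rho_1^{-1}=B_{2,3},\quad \rho_1\rho_3\rho_1^{-1}=\rho_3^{-1}B_{2,3},\quad \rho_2B_{2,3}\rho_2^{-1}=\rho_3^{-1}B_{2,3}^{-1}\rho_3,\quad \rho_2\rho_3\rho_2^{-1}=\rho_3^{-1}B_{2,3}^{-1}\rho_3^2,$$ $$\rho_1\rho_2\rho_1\rho_2^{-1}=B_{2,3}^{-1}\rho_3^2,\quad \rho_1^{-2}\rho_2^2=B_{2,3}\rho_3^{-2}B_{2,3}$$ (together with the formulas for conjugation by $\rho_1^{-1}$ and $\rho_2^{-1}$ implied by the first four). The kernel $\pi_1(\mathbb{R}P^2\setminus\{x_1,x_2\})$ is free of rank $2$ with basis $\{\rho_3,B_{2,3}\}$, and $p_\ast$ sends $\rho_1\mapsto\rho_1$, $\rho_2\mapsto\rho_2$, $\rho_3\mapsto 1$, $B_{2,3}\mapsto 1$. *)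

theory Defs
  imports "HOL-Analysis.Analysis" "HOL-Algebra.Exact_Sequence"
begin

subsection \<open>Fundamental groups\<close>

definition loops :: "'a::topological_space set \<Rightarrow> 'a \<Rightarrow> (real \<Rightarrow> 'a) set" where
  "loops X x = {p. path p \<and> path_image p \<subseteq> X \<and> pathstart p = x \<and> pathfinish p = x}"

definition path_class :: "'a::topological_space set \<Rightarrow> (real \<Rightarrow> 'a) \<Rightarrow> (real \<Rightarrow> 'a) set" where
  "path_class X p = {q. homotopic_paths X p q}"

text \<open>Products are read from left to right: \<open>[p] \<otimes> [q]\<close> is the class of
  \<open>p\<close> followed by \<open>q\<close>.\<close>

definition fundamental_group ::
    "'a::topological_space set \<Rightarrow> 'a \<Rightarrow> (real \<Rightarrow> 'a) set monoid" where
  "fundamental_group X x =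
     \<lparr>carrier = path_class X ` loops X x,
      monoid.mult = (\<lambda>A B. \<Union>p\<in>A. \<Union>q\<in>B. path_class X (p +++ q)),
      one = path_class X (\<lambda>_. x)\<rparr>"

text \<open>The map induced on homotopy classes by a map \<open>f\<close> into \<open>Y\<close>:
  \<open>[p]\<close> is sent to \<open>[f \<circ> p]\<close>.\<close>

definition induced_map :: "'b::topological_space set \<Rightarrow> ('a::topological_space \<Rightarrow> 'b)
    \<Rightarrow> (real \<Rightarrow> 'a) set \<Rightarrow> (real \<Rightarrow> 'b) set" where
  "induced_map Y f A = (\<Union>p\<in>A. path_class Y (f \<circ> p))"

text \<open>The library notion \<^const>\<open>short_exact_sequence\<close> requires the three groups to have elements
  of the same type; this is the same notion for groups over different types.\<close>

definition short_exact ::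
    "'a monoid \<Rightarrow> 'b monoid \<Rightarrow> 'c monoid \<Rightarrow> ('a \<Rightarrow> 'b) \<Rightarrow> ('b \<Rightarrow> 'c) \<Rightarrow> bool" where
  "short_exact K G H i p \<longleftrightarrow>
     group_hom K G i \<and> group_hom G H p \<and>
     inj_on i (carrier K) \<and>
     i ` carrier K = kernel G H p \<and>
     p ` carrier G = carrier H"


subsection \<open>The real projective plane\<close>

typedef rp2 = "{L :: (real^3) set. subspace L \<and> dim L = 1}"
proof
  show "span {axis 1 1 :: real^3} \<in> {L. subspace L \<and> dim L = 1}"
    by (simp add: dim_insert axis_eq_0_iff)
qed

text \<open>The point with homogeneous coordinates \<open>u\<close>, meaningful only for \<open>u \<noteq> 0\<close>.\<close>

definition rp2_point :: "real^3 \<Rightarrow> rp2" where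
  "rp2_point u = Abs_rp2 (span {u})"

text \<open>The quotient topology with respect to \<^const>\<open>rp2_point\<close> on the nonzero vectors.\<close>

instantiation rp2 :: topological_space
begin

definition open_rp2 :: "rp2 set \<Rightarrow> bool" where
  "open_rp2 U \<longleftrightarrow> open {u. u \<noteq> 0 \<and> rp2_point u \<in> U}"

instance
proof
  have "{u :: real^3. u \<noteq> 0 \<and> rp2_point u \<in> UNIV} = - {0}"
    by auto
  then show "open (UNIV :: rp2 set)"
    unfolding open_rp2_def by auto
next
  fix S T :: "rp2 set"
  assume "open S" "open T"
  moreover have "{u. u \<noteq> 0 \<and> rp2_point u \<in> S \<inter> T} =
      {u. u \<noteq> 0 \<and> rp2_point u \<in> S} \<inter> {u. u \<noteq> 0 \<and> rp2_point u \<in> T}"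
    by auto
  ultimately show "open (S \<inter> T)"
    unfolding open_rp2_def by auto
next
  fix K :: "rp2 set set"
  assume "\<forall>S\<in>K. open S"
  moreover have "{u. u \<noteq> 0 \<and> rp2_point u \<in> \<Union>K} =
      (\<Union>S\<in>K. {u. u \<noteq> 0 \<and> rp2_point u \<in> S})"
    by auto
  ultimately show "open (\<Union>K)"
    unfolding open_rp2_def by auto
qed

end


subsection \<open>Pure braid groups of the projective plane\<close>

text \<open>The space \<open>F\<^sub>n\<close> of ordered \<open>n\<close>-tuples of distinct points, with \<open>n = CARD('n)\<close>.\<close>

definition config_space :: "('a^'n) set" where
  "config_space = {x. inj (\<lambda>i. x $ i)}"

definition pure_braid_group :: "rp2^'n \<Rightarrow> (real \<Rightarrow> rp2^'n) set monoid" where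
  "pure_braid_group x = fundamental_group config_space x"

text \<open>The projective plane is the affine chart \<open>{[X : Y : 1]}\<close> together with the line at infinity.
  The base points are the points \<open>(a\<^sub>i, 0)\<close> on the horizontal axis of the chart. The disc is a large
  disc of the chart centred on this axis; the twisted band joins the left end of the disc to its
  right end, and is a neighbourhood of an arc crossing the line at infinity at the horizontal
  direction \<open>[1 : 0 : 0]\<close>. The complement of the disc and the band is an open disc, around
  the vertical direction \<open>[0 : 1 : 0]\<close>.\<close>

definition base_points :: "real^'n \<Rightarrow> rp2^'n" where
  "base_points a = (\<chi> i. rp2_point (vector [a $ i, 0, 1]))"

text \<open>In the chart this is the path \<open>t \<mapsto> (a - tan \<pi>t, sin \<pi>t)\<close>: starting at \<open>(a, 0)\<close>, it
  goes left, above all the base points, crosses infinity at \<open>t = 1/2\<close>, and comes back from the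
  right, again above all the base points. (A loop passing below the other points on one of the two
  legs would define a different braid.) With this orientation, with \<open>a\<^sub>1 < a\<^sub>2 < a\<^sub>3\<close>, with products
  read from left to right, and with \<open>B\<^sub>2\<^sub>,\<^sub>3\<close> the braid in which \<open>x\<^sub>3\<close> turns once counterclockwise
  around \<open>x\<^sub>2\<close>, the relations of \<open>P\<^sub>3\<close> include \<open>\<rho>\<^sub>1 \<rho>\<^sub>3 \<rho>\<^sub>1\<^sup>-\<^sup>1 = \<rho>\<^sub>3\<^sup>-\<^sup>1 B\<^sub>2\<^sub>,\<^sub>3\<close> and
  \<open>\<rho>\<^sub>2 \<rho>\<^sub>3 \<rho>\<^sub>2\<^sup>-\<^sup>1 = \<rho>\<^sub>3\<^sup>-\<^sup>1 B\<^sub>2\<^sub>,\<^sub>3\<^sup>-\<^sup>1 \<rho>\<^sub>3\<^sup>2\<close>.\<close>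

definition band_loop :: "real \<Rightarrow> real \<Rightarrow> rp2" where
  "band_loop a t = rp2_point (vector
     [a * cos (pi * t) - sin (pi * t), sin (pi * t) * cos (pi * t), cos (pi * t)])"

text \<open>The pure braid \<open>\<rho>\<^sub>i\<close>: the \<open>i\<close>-th point goes once round the band, the others do not move.\<close>

definition rho :: "real^'n \<Rightarrow> 'n \<Rightarrow> (real \<Rightarrow> rp2^'n) set" where
  "rho a i = path_class config_space
     (\<lambda>t. \<chi> j. if j = i then band_loop (a $ i) t else base_points a $ j)"

text \<open>The projection \<open>(x\<^sub>1, x\<^sub>2, x\<^sub>3) \<mapsto> (x\<^sub>1, x\<^sub>2)\<close>, and the map \<open>(x\<^sub>1, x\<^sub>2), y \<mapsto> (x\<^sub>1, x\<^sub>2, y)\<close>.\<close>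

definition forget3 :: "'a^3 \<Rightarrow> 'a^2" where
  "forget3 x = (\<chi> i. if i = 1 then x $ 1 else x $ 2)"

definition add3 :: "'a^2 \<Rightarrow> 'a \<Rightarrow> 'a^3" where
  "add3 x y = (\<chi> i. if i = 1 then x $ 1 else if i = 2 then x $ 2 else y)"

definition p_star :: "(real \<Rightarrow> rp2^3) set \<Rightarrow> (real \<Rightarrow> rp2^2) set" where
  "p_star = induced_map config_space forget3"

text \<open>The fibre of the projection over \<open>(x\<^sub>1, x\<^sub>2)\<close> is identified with the projective plane minus
  \<open>x\<^sub>1, x\<^sub>2\<close> through \<^term>\<open>add3\<close>.\<close>

definition fibre_group :: "rp2^3 \<Rightarrow> (real \<Rightarrow> rp2) set monoid" where
  "fibre_group x = fundamental_group (UNIV - {x $ 1, x $ 2}) (x $ 3)"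

definition fibre_inclusion_star :: "rp2^3 \<Rightarrow> (real \<Rightarrow> rp2) set \<Rightarrow> (real \<Rightarrow> rp2^3) set" where
  "fibre_inclusion_star x = induced_map config_space (add3 (forget3 x))"

end

theory Submission
  imports Defs
begin

text \<open>A pair of distinct lines of \<open>\<real>\<^sup>3\<close> determines a third line, its orthogonal complement, so
  \<open>(x\<^sub>1, x\<^sub>2) \<mapsto> (x\<^sub>1, x\<^sub>2, x\<^sub>1 \<times> x\<^sub>2)\<close> is a section of the projection of configuration spaces. It does not
  preserve the base points; the splitting is the induced map conjugated by the path on which \<open>x\<^sub>3\<close> goes
  vertically downwards, from its place on the axis to the point \<open>[0 : 1 : 0] = x\<^sub>1 \<times> x\<^sub>2\<close>. Thus no
  presentation of the groups is needed, but the values of the splitting on the generators must be found.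
  If \<open>d\<close> and \<open>u\<close> are the downward and the upward path, and \<open>\<sigma>\<close> is the section, then
  \<open>\<rho>\<^sub>3 = u d\<^sup>-\<^sup>1\<close>, \<open>\<rho>\<^sub>1 = d \<sigma>(\<rho>\<^sub>1) u\<^sup>-\<^sup>1\<close> and \<open>\<rho>\<^sub>2 = d u\<^sup>-\<^sup>1 d \<sigma>(\<rho>\<^sub>2) d\<^sup>-\<^sup>1\<close>; each of the three is a linear
  homotopy of \<open>x\<^sub>3\<close> in the coordinates of a frame that moves with \<open>x\<^sub>1\<close> and \<open>x\<^sub>2\<close>.

  Exactness: a homotopy of loops of configurations lifts to unit vectors, and
  the frame \<open>x\<^sub>1\<close>, \<open>x\<^sub>2\<close>, \<open>x\<^sub>1 \<times> x\<^sub>2\<close> trivializes the fibration along the lift. On the edges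
  where the first two points rest the frame is constant.\<close>

subsection \<open>Fundamental groups\<close>

lemma path_class_eq_iff:
  assumes "path p" "path_image p \<subseteq> S"
  shows "path_class S p = path_class S q \<longleftrightarrow> homotopic_paths S p q"
proof
  assume "path_class S p = path_class S q"
  moreover have "p \<in> path_class S p"
    using assms by (simp add: path_class_def)
  ultimately show "homotopic_paths S p q"
    by (auto simp: path_class_def intro: homotopic_paths_sym)
next
  assume "homotopic_paths S p q"
  then show "path_class S p = path_class S q"
    unfolding path_class_def by (blast intro: homotopic_paths_sym homotopic_paths_trans)
qed

lemma path_class_eqI: "homotopic_paths S p q \<Longrightarrow> path_class S p = path_class S q"
  using path_class_eq_iff[of p S q] homotopic_paths_imp_path[of S p q]
    homotopic_paths_imp_subset[of S p q] by auto

lemma loopsD: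
  assumes "p \<in> loops X x"
  shows "path p" "path_image p \<subseteq> X" "pathstart p = x" "pathfinish p = x" "x \<in> X"
  using assms pathstart_in_path_image unfolding loops_def by auto

lemma fundamental_group_carrier: "carrier (fundamental_group X x) = path_class X ` loops X x"
  by (simp add: fundamental_group_def)

lemma fundamental_group_carrierE:
  assumes "A \<in> carrier (fundamental_group X x)"
  obtains p where "p \<in> loops X x" "A = path_class X p"
  using assms by (auto simp: fundamental_group_carrier)

lemma fundamental_group_one: "\<one>\<^bsub>fundamental_group X x\<^esub> = path_class X (\<lambda>_. x)"
  by (simp add: fundamental_group_def)

text \<open>The product is a union over all representatives of the two classes. Joins respect
  homotopy, so every set in this union is the class of \<open>p +++ q\<close>, and the union is not
  empty because \<open>p\<close> and \<open>q\<close> lie in their own classes.\<close>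

lemma fundamental_group_mult:
  assumes "p \<in> loops X x" "q \<in> loops X x"
  shows "path_class X p \<otimes>\<^bsub>fundamental_group X x\<^esub> path_class X q = path_class X (p +++ q)"
proof -
  have eq: "path_class X (p' +++ q') = path_class X (p +++ q)"
    if "p' \<in> path_class X p" "q' \<in> path_class X q" for p' q'
  proof -
    have "homotopic_paths X (p +++ q) (p' +++ q')"
      using that assms by (intro homotopic_paths_join) (auto simp: path_class_def loops_def)
    then show ?thesis
      by (rule path_class_eqI[symmetric])
  qed
  have "p \<in> path_class X p" "q \<in> path_class X q"
    using assms by (auto simp: path_class_def loops_def)
  moreover have "(\<Union>p'\<in>path_class X p. \<Union>q'\<in>path_class X q. path_class X (p' +++ q')) =
      (\<Union>p'\<in>path_class X p. \<Union>q'\<in>path_class X q. path_class X (p +++ q))"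
    by (intro SUP_cong refl eq)
  ultimately show ?thesis
    by (auto simp: fundamental_group_def)
qed

lemma const_in_loops: "x \<in> X \<Longrightarrow> (\<lambda>_. x) \<in> loops X x"
  by (auto simp: loops_def path_def path_image_def pathstart_def pathfinish_def)

lemma join_in_loops: "p \<in> loops X x \<Longrightarrow> q \<in> loops X x \<Longrightarrow> p +++ q \<in> loops X x"
  by (auto simp: loops_def path_image_join)

lemma reversepath_in_loops: "p \<in> loops X x \<Longrightarrow> reversepath p \<in> loops X x"
  by (auto simp: loops_def)

text \<open>The homotopy is made in the interval \<open>{0..1}\<close>, for the identity path, and
  pushed forward along \<open>p\<close>. Thus \<open>S\<close> may lie in a space without linear
  structure, such as \<open>rp2^3\<close>. The next two lemmas follow the same pattern.\<close>

lemma homotopic_paths_const_join: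
  assumes "path p" "path_image p \<subseteq> S"
  shows "homotopic_paths S ((\<lambda>_. pathstart p) +++ p) p"
proof -
  have "homotopic_paths {0..1} ((\<lambda>_. 0) +++ (\<lambda>t. t)) (\<lambda>t::real. t)"
    using homotopic_paths_lid[of "\<lambda>t::real. t" "{0..1}"]
    by (auto simp: path_def path_image_def pathstart_def linepath_refl)
  then have "homotopic_paths S (p \<circ> ((\<lambda>_. 0) +++ (\<lambda>t. t))) (p \<circ> (\<lambda>t. t))"
    by (rule homotopic_paths_continuous_image) (use assms in \<open>auto simp: path_def path_image_def\<close>)
  moreover have "p \<circ> ((\<lambda>_. 0) +++ (\<lambda>t. t)) = (\<lambda>_. pathstart p) +++ p"
    by (auto simp: joinpaths_def pathstart_def)
  ultimately show ?thesis
    by (simp add: o_def)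
qed

lemma homotopic_paths_join_const:
  assumes "path p" "path_image p \<subseteq> S"
  shows "homotopic_paths S (p +++ (\<lambda>_. pathfinish p)) p"
proof -
  have "homotopic_paths {0..1} ((\<lambda>t. t) +++ (\<lambda>_. 1)) (\<lambda>t::real. t)"
    using homotopic_paths_rid[of "\<lambda>t::real. t" "{0..1}"]
    by (auto simp: path_def path_image_def pathfinish_def linepath_refl)
  then have "homotopic_paths S (p \<circ> ((\<lambda>t. t) +++ (\<lambda>_. 1))) (p \<circ> (\<lambda>t. t))"
    by (rule homotopic_paths_continuous_image) (use assms in \<open>auto simp: path_def path_image_def\<close>)
  moreover have "p \<circ> ((\<lambda>t. t) +++ (\<lambda>_. 1)) = p +++ (\<lambda>_. pathfinish p)"
    by (auto simp: joinpaths_def pathfinish_def)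
  ultimately show ?thesis
    by (simp add: o_def)
qed

lemma homotopic_paths_join_reversepath:
  assumes "path p" "path_image p \<subseteq> S"
  shows "homotopic_paths S (p +++ reversepath p) (\<lambda>_. pathstart p)"
proof -
  have "homotopic_paths {0..1} ((\<lambda>t. t) +++ reversepath (\<lambda>t. t)) (\<lambda>t::real. 0)"
    using homotopic_paths_rinv[of "\<lambda>t::real. t" "{0..1}"]
    by (auto simp: path_def path_image_def pathstart_def linepath_refl)
  then have "homotopic_paths S (p \<circ> ((\<lambda>t. t) +++ reversepath (\<lambda>t. t))) (p \<circ> (\<lambda>_. 0))"
    by (rule homotopic_paths_continuous_image) (use assms in \<open>auto simp: path_def path_image_def\<close>)
  moreover have "p \<circ> ((\<lambda>t. t) +++ reversepath (\<lambda>t. t)) = p +++ reversepath p"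
    by (auto simp: joinpaths_def reversepath_def)
  ultimately show ?thesis
    by (simp add: o_def pathstart_def)
qed

lemma homotopic_paths_cancel:
  assumes p: "path p" "path_image p \<subseteq> S" and q: "path q" "path_image q \<subseteq> S"
    and "pathstart q = pathstart p"
  shows "homotopic_paths S (p +++ (reversepath p +++ q)) q"
proof -
  have "homotopic_paths S (p +++ (reversepath p +++ q)) ((p +++ reversepath p) +++ q)"
    using assms by (intro homotopic_paths_assoc) auto
  also have "homotopic_paths S \<dots> ((\<lambda>_. pathstart p) +++ q)"
    using assms homotopic_paths_join_reversepath[OF p]
    by (intro homotopic_paths_join) auto
  also have "homotopic_paths S \<dots> q"
    using homotopic_paths_const_join[OF q] assms by simp
  finally show ?thesis .
qed

lemma group_fundamental_group:
  assumes "x \<in> X"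
  shows "group (fundamental_group X x)"
proof (rule groupI)
  fix A B C
  assume "A \<in> carrier (fundamental_group X x)" "B \<in> carrier (fundamental_group X x)"
    "C \<in> carrier (fundamental_group X x)"
  then obtain p q r where *: "p \<in> loops X x" "q \<in> loops X x" "r \<in> loops X x"
    "A = path_class X p" "B = path_class X q" "C = path_class X r"
    by (auto simp: fundamental_group_carrier)
  then show "A \<otimes>\<^bsub>fundamental_group X x\<^esub> B \<in> carrier (fundamental_group X x)"
    by (auto simp: fundamental_group_mult fundamental_group_carrier intro: join_in_loops)
  show "A \<otimes>\<^bsub>fundamental_group X x\<^esub> B \<otimes>\<^bsub>fundamental_group X x\<^esub> C =
      A \<otimes>\<^bsub>fundamental_group X x\<^esub> (B \<otimes>\<^bsub>fundamental_group X x\<^esub> C)"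
    using path_class_eqI[OF homotopic_paths_assoc[of p X q r]] *
    by (simp add: fundamental_group_mult join_in_loops loopsD[OF *(1)] loopsD[OF *(2)] loopsD[OF *(3)])
next
  show "\<one>\<^bsub>fundamental_group X x\<^esub> \<in> carrier (fundamental_group X x)"
    using assms by (auto simp: fundamental_group_one fundamental_group_carrier const_in_loops)
next
  fix A
  assume "A \<in> carrier (fundamental_group X x)"
  then obtain p where p: "p \<in> loops X x" "A = path_class X p"
    by (rule fundamental_group_carrierE)
  then show "\<one>\<^bsub>fundamental_group X x\<^esub> \<otimes>\<^bsub>fundamental_group X x\<^esub> A = A"
    using path_class_eqI[OF homotopic_paths_const_join[of p X]] assms
    by (simp add: fundamental_group_one fundamental_group_mult const_in_loops loopsD[OF p(1)])
  have "path_class X (reversepath p) \<otimes>\<^bsub>fundamental_group X x\<^esub> A =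
      \<one>\<^bsub>fundamental_group X x\<^esub>"
    using path_class_eqI[OF homotopic_paths_join_reversepath[of "reversepath p" X]] p
    by (simp add: fundamental_group_one fundamental_group_mult reversepath_in_loops loopsD[OF p(1)])
  then show "\<exists>B\<in>carrier (fundamental_group X x).
      B \<otimes>\<^bsub>fundamental_group X x\<^esub> A = \<one>\<^bsub>fundamental_group X x\<^esub>"
    using p by (auto simp: fundamental_group_carrier reversepath_in_loops)
qed

section \<open>Induced homomorphisms, and cancellation in products of paths\<close>

lemma compose_in_loops:
  assumes "continuous_on X f" "f ` X \<subseteq> Y" "p \<in> loops X x"
  shows "f \<circ> p \<in> loops Y (f x)"
proof -
  have "continuous_on (path_image p) f"
    using assms by (auto simp: loops_def intro: continuous_on_subset)
  then have "path (f \<circ> p)"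
    using assms by (auto simp: loops_def intro: path_continuous_image)
  then show ?thesis
    using assms by (auto simp: loops_def path_image_compose pathstart_compose pathfinish_compose)
qed

lemma induced_map_path_class:
  assumes "continuous_on X f" "f ` X \<subseteq> Y" "p \<in> loops X x"
  shows "induced_map Y f (path_class X p) = path_class Y (f \<circ> p)"
proof -
  have eq: "path_class Y (f \<circ> q) = path_class Y (f \<circ> p)" if "q \<in> path_class X p" for q
  proof -
    have "homotopic_paths Y (f \<circ> p) (f \<circ> q)"
      by (rule homotopic_paths_continuous_image[of X]) (use that assms in \<open>auto simp: path_class_def\<close>)
    then show ?thesis
      by (rule path_class_eqI[symmetric])
  qed
  have "p \<in> path_class X p"
    using assms by (auto simp: path_class_def loops_def)
  moreover have "(\<Union>q\<in>path_class X p. path_class Y (f \<circ> q)) =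
      (\<Union>q\<in>path_class X p. path_class Y (f \<circ> p))"
    by (intro SUP_cong refl eq)
  ultimately show ?thesis
    by (auto simp: induced_map_def)
qed

lemma induced_map_group_hom:
  assumes f: "continuous_on X f" "f ` X \<subseteq> Y" and "x \<in> X"
  shows "group_hom (fundamental_group X x) (fundamental_group Y (f x)) (induced_map Y f)"
proof -
  have "induced_map Y f \<in> hom (fundamental_group X x) (fundamental_group Y (f x))"
  proof (rule homI)
    fix A assume "A \<in> carrier (fundamental_group X x)"
    then obtain p where "p \<in> loops X x" "A = path_class X p"
      by (rule fundamental_group_carrierE)
    then show "induced_map Y f A \<in> carrier (fundamental_group Y (f x))"
      using f by (auto simp: induced_map_path_class fundamental_group_carrier compose_in_loops)
  next
    fix A B
    assume "A \<in> carrier (fundamental_group X x)" "B \<in> carrier (fundamental_group X x)"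
    then obtain p q where "p \<in> loops X x" "A = path_class X p" "q \<in> loops X x" "B = path_class X q"
      by (auto simp: fundamental_group_carrier)
    then show "induced_map Y f (A \<otimes>\<^bsub>fundamental_group X x\<^esub> B) =
        induced_map Y f A \<otimes>\<^bsub>fundamental_group Y (f x)\<^esub> induced_map Y f B"
      using f by (simp add: fundamental_group_mult induced_map_path_class[OF f, of _ x] join_in_loops
          compose_in_loops[OF f] path_compose_join)
  qed
  then show ?thesis
    using assms by (auto simp: group_hom_def group_hom_axioms_def intro!: group_fundamental_group)
qed

text \<open>The inner pair \<open>reversepath r +++ r\<close> is contracted. For
  \<open>r = p\<close> this makes conjugation by a path multiplicative; with \<open>p\<close> the
  downward and \<open>r\<close> the upward leg it computes the product of \<open>rho a 1\<close> and
  \<open>rho a 3\<close>.\<close>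

lemma homotopic_paths_cancel_middle:
  assumes "path p" "path_image p \<subseteq> S" "path q" "path_image q \<subseteq> S"
    and "path r" "path_image r \<subseteq> S" "path s" "path_image s \<subseteq> S"
    and "pathfinish p = pathstart q" "pathfinish q = pathfinish r" "pathfinish r = pathstart s"
  shows "homotopic_paths S ((p +++ (q +++ reversepath r)) +++ (r +++ s)) (p +++ (q +++ s))"
proof -
  have "homotopic_paths S ((p +++ (q +++ reversepath r)) +++ (r +++ s))
      (p +++ ((q +++ reversepath r) +++ (r +++ s)))"
    using assms by (intro homotopic_paths_sym[OF homotopic_paths_assoc]) (auto simp: path_image_join)
  also have "homotopic_paths S \<dots> (p +++ (q +++ (reversepath r +++ (r +++ s))))"
    using assms
    by (intro homotopic_paths_join homotopic_paths_sym[OF homotopic_paths_assoc])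
      (auto simp: path_image_join)
  also have "homotopic_paths S \<dots> (p +++ (q +++ s))"
    using assms homotopic_paths_cancel[of "reversepath r" S s]
    by (intro homotopic_paths_join) auto
  finally show ?thesis .
qed

text \<open>The pattern of \<open>rho a 3\<close> followed by \<open>rho a 2\<close>: with
  \<open>p\<close> the upward and \<open>q\<close> the downward leg, the first factor is inverse to
  the one after it.\<close>

lemma homotopic_paths_cancel_outer:
  assumes "path p" "path_image p \<subseteq> S" "path q" "path_image q \<subseteq> S" "path r" "path_image r \<subseteq> S"
    and "pathfinish p = pathfinish q" "pathstart p = pathstart r"
  shows "homotopic_paths S ((p +++ reversepath q) +++ ((q +++ reversepath p) +++ r)) r"
proof -
  have "homotopic_paths S ((p +++ reversepath q) +++ ((q +++ reversepath p) +++ r))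
      (p +++ (reversepath q +++ ((q +++ reversepath p) +++ r)))"
    using assms by (intro homotopic_paths_sym[OF homotopic_paths_assoc]) (auto simp: path_image_join)
  also have "homotopic_paths S \<dots> (p +++ (reversepath q +++ (q +++ (reversepath p +++ r))))"
    using assms
    by (intro homotopic_paths_join homotopic_paths_sym[OF homotopic_paths_assoc])
      (auto simp: path_image_join)
  also have "homotopic_paths S \<dots> (p +++ (reversepath p +++ r))"
    using assms homotopic_paths_cancel[of "reversepath q" S "reversepath p +++ r"]
    by (rule_tac homotopic_paths_join) (auto simp: path_image_join)
  also have "homotopic_paths S \<dots> r"
    using assms by (intro homotopic_paths_cancel) auto
  finally show ?thesis .
qed

subsection \<open>Lifting maps into the projective plane\<close>

lemma cross3_eq_0_iff_parallel:
  fixes u v :: "real^3"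
  assumes "u \<noteq> 0"
  shows "cross3 u v = 0 \<longleftrightarrow> (\<exists>c. v = c *\<^sub>R u)"
  using assms by (auto simp: cross_eq_0 collinear_lemma)

text \<open>Distinctness of points becomes a polynomial condition on homogeneous coordinates;
  membership in configuration spaces is always tested in this form.\<close>

lemma rp2_point_eq_iff:
  assumes "u \<noteq> 0" "v \<noteq> 0"
  shows "rp2_point u = rp2_point v \<longleftrightarrow> cross3 u v = 0"
proof -
  have "rp2_point u = rp2_point v \<longleftrightarrow> span {u} = span {v}"
    unfolding rp2_point_def using assms
    by (subst Abs_rp2_inject) (auto simp: dim_insert)
  also have "\<dots> \<longleftrightarrow> (\<exists>c. v = c *\<^sub>R u)"
  proof
    assume "span {u} = span {v}"
    then have "v \<in> span {u}"
      by (simp add: span_base)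
    then show "\<exists>c. v = c *\<^sub>R u"
      by (auto simp: span_singleton)
  next
    assume "\<exists>c. v = c *\<^sub>R u"
    then obtain c where "v = c *\<^sub>R u" ..
    moreover from this have "c \<noteq> 0"
      using assms by auto
    ultimately have "u = (1 / c) *\<^sub>R v"
      by simp
    with \<open>v = c *\<^sub>R u\<close> have "u \<in> span {v}" "v \<in> span {u}"
      unfolding span_singleton by blast+
    then show "span {u} = span {v}"
      using span_eq[of "{u}" "{v}"] by simp
  qed
  also have "\<dots> \<longleftrightarrow> cross3 u v = 0"
    using assms by (simp add: cross3_eq_0_iff_parallel)
  finally show ?thesis .
qed

lemma rp2_point_scaleR: "c \<noteq> 0 \<Longrightarrow> rp2_point (c *\<^sub>R u) = rp2_point u"
  by (cases "u = 0") (auto simp: rp2_point_eq_iff cross_mult_left)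

lemma rp2_point_minus [simp]: "rp2_point (- u) = rp2_point u"
  using rp2_point_scaleR[of "-1" u] by simp

lemma rp2_point_unit_surj: "\<exists>u. norm u = 1 \<and> rp2_point u = L"
proof -
  obtain V where V: "L = Abs_rp2 V" "subspace V" "dim V = 1"
    by (cases L) auto
  then obtain B where B: "B \<subseteq> V" "independent B" "V \<subseteq> span B" "card B = 1"
    using basis_exists[of V] by metis
  then obtain b where b: "B = {b}"
    by (auto simp: card_1_singleton_iff)
  have "b \<noteq> 0"
    using B(2) b dependent_zero[of B] by auto
  moreover have "V = span {b}"
    using span_subspace[OF B(1) B(3) V(2)] b by simp
  ultimately have "rp2_point b = L"
    using V by (simp add: rp2_point_def)
  then have "rp2_point ((1 / norm b) *\<^sub>R b) = L"
    using \<open>b \<noteq> 0\<close> by (subst rp2_point_scaleR) auto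
  then show ?thesis
    using \<open>b \<noteq> 0\<close> by (intro exI[of _ "(1 / norm b) *\<^sub>R b"]) simp
qed

text \<open>An arbitrary choice between two opposite vectors, with no continuity in
  \<open>L\<close>. A construction that uses it has to be insensitive to the sign.\<close>

definition rp2_unit :: "rp2 \<Rightarrow> real^3" where
  "rp2_unit L = (SOME u. norm u = 1 \<and> rp2_point u = L)"

lemma norm_rp2_unit [simp]: "norm (rp2_unit L) = 1"
  and rp2_point_unit [simp]: "rp2_point (rp2_unit L) = L"
  using someI_ex[OF rp2_point_unit_surj[of L]] by (auto simp: rp2_unit_def)

lemma rp2_unit_nonzero [simp]: "rp2_unit L \<noteq> 0"
  using norm_rp2_unit[of L] norm_zero by force

lemma rp2_unit_point:
  assumes "u \<noteq> 0"
  obtains c where "c \<noteq> 0" "u = c *\<^sub>R rp2_unit (rp2_point u)"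
proof -
  have "cross3 (rp2_unit (rp2_point u)) u = 0"
    using assms rp2_point_eq_iff[of "rp2_unit (rp2_point u)" u] by simp
  then obtain c where "u = c *\<^sub>R rp2_unit (rp2_point u)"
    using cross3_eq_0_iff_parallel rp2_unit_nonzero by blast
  moreover from this have "c \<noteq> 0"
    using assms by auto
  ultimately show ?thesis
    using that by blast
qed

lemma continuous_on_rp2_point: "continuous_on (- {0}) rp2_point"
proof -
  have "open (rp2_point -` U \<inter> - {0})" if "open U" for U
  proof -
    have "rp2_point -` U \<inter> - {0} = {u. u \<noteq> 0 \<and> rp2_point u \<in> U}"
      by auto
    then show ?thesis
      using that by (simp add: open_rp2_def)
  qed
  then show ?thesis
    by (subst continuous_on_open_vimage) auto
qed

lemma continuous_on_rp2_point_compose: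
  assumes "continuous_on S f" "\<And>x. x \<in> S \<Longrightarrow> f x \<noteq> 0"
  shows "continuous_on S (\<lambda>x. rp2_point (f x))"
  by (rule continuous_on_compose2[OF continuous_on_rp2_point assms(1)]) (use assms in auto)

section \<open>The projective plane as a space of matrices, and its double covering by the
  sphere\<close>

text \<open>For a unit vector \<open>u\<close> this is the matrix of the orthogonal projection to the line of \<open>u\<close>.
  It embeds the projective plane into a normed space, as the covering theory of the
  library requires.\<close>

definition outer_square :: "real^3 \<Rightarrow> real^3^3" where
  "outer_square u = (\<chi> i j. u $ i * u $ j)"

lemma outer_square_mult: "outer_square u *v w = (u \<bullet> w) *\<^sub>R u"
  by (simp add: outer_square_def matrix_vector_mult_def vec_eq_iff inner_vec_def sum_3 algebra_simps)

lemma outer_square_scaleR: "outer_square (c *\<^sub>R u) = c\<^sup>2 *\<^sub>R outer_square u"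
  by (simp add: outer_square_def vec_eq_iff power2_eq_square)

lemma continuous_on_outer_square: "continuous_on S outer_square"
  unfolding outer_square_def by (intro continuous_intros)

text \<open>Applying both matrices to \<open>u\<close> shows that \<open>u\<close> is the multiple
  of \<open>v\<close> by \<open>v \<bullet> u\<close>.\<close>

lemma outer_square_unit_eqD:
  assumes "outer_square u = outer_square v" "norm u = 1" "norm v = 1"
  shows "rp2_point u = rp2_point v"
proof -
  have "u = (v \<bullet> u) *\<^sub>R v"
    using outer_square_mult[of u u] outer_square_mult[of v u] assms
    by (simp add: dot_square_norm)
  moreover have "u \<noteq> 0" "v \<noteq> 0"
    using assms by auto
  ultimately show ?thesis
    using rp2_point_scaleR[of "v \<bullet> u" v] by (cases "v \<bullet> u = 0") auto
qed

definition rp2_matrix :: "rp2 \<Rightarrow> real^3^3" where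
  "rp2_matrix L = outer_square (rp2_unit L)"

text \<open>The right-hand side is homogeneous of degree 0 in \<open>u\<close>. It exhibits the
  matrix as a rational, hence continuous, function of the homogeneous coordinates, whatever choice
  \<open>rp2_unit\<close> has made.\<close>

lemma rp2_matrix_point:
  assumes "u \<noteq> 0"
  shows "rp2_matrix (rp2_point u) = (1 / (u \<bullet> u)) *\<^sub>R outer_square u"
proof -
  obtain c where c: "c \<noteq> 0" "u = c *\<^sub>R rp2_unit (rp2_point u)"
    using rp2_unit_point[OF assms] .
  define e where "e = rp2_unit (rp2_point u)"
  have "u = c *\<^sub>R e" "e \<bullet> e = 1"
    using c by (simp_all add: e_def dot_square_norm)
  then show ?thesis
    using \<open>c \<noteq> 0\<close> unfolding rp2_matrix_def e_def[symmetric]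
    by (simp add: outer_square_scaleR power2_eq_square)
qed

lemma continuous_on_rp2_matrix: "continuous_on S rp2_matrix"
proof -
  have "continuous_on (- {0}) (\<lambda>u. (1 / (u \<bullet> u)) *\<^sub>R outer_square u)"
    by (intro continuous_intros continuous_on_outer_square) auto
  then have cont: "continuous_on (- {0}) (\<lambda>u. rp2_matrix (rp2_point u))"
    by (rule continuous_on_eq) (simp add: rp2_matrix_point)
  have "open (rp2_matrix -` U)" if "open U" for U
  proof -
    have "open ((\<lambda>u. rp2_matrix (rp2_point u)) -` U \<inter> - {0})"
      using cont that by (subst (asm) continuous_on_open_vimage) auto
    moreover have "(\<lambda>u. rp2_matrix (rp2_point u)) -` U \<inter> - {0} =
        {u. u \<noteq> 0 \<and> rp2_point u \<in> rp2_matrix -` U}"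
      by auto
    ultimately show ?thesis
      by (simp add: open_rp2_def)
  qed
  then have "continuous_on UNIV rp2_matrix"
    by (subst continuous_on_open_vimage) auto
  then show ?thesis
    using continuous_on_subset by blast
qed

text \<open>The antipodal double covering. Around the line of \<open>e\<close>, the evenly covered
  set consists of the lines not orthogonal to \<open>e\<close>; its two sheets are the open
  hemispheres centred at \<open>e\<close> and \<open>- e\<close>.\<close>

lemma covering_space_outer_square:
  "covering_space (sphere 0 1) outer_square (outer_square ` sphere 0 1)"
proof (rule covering_spaceI)
  fix x assume "x \<in> outer_square ` sphere 0 1"
  then obtain e where e: "norm e = 1" "x = outer_square e"
    by auto
  let ?S = "outer_square ` sphere 0 1"
  \<comment> \<open>For the matrix of a unit vector \<open>u\<close> the number
    \<open>e \<bullet> (A *v e)\<close> is the square of \<open>u \<bullet> e\<close>, so positivity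
    says that \<open>u\<close> is not orthogonal to \<open>e\<close>.\<close>
  define T where "T = {A \<in> ?S. 0 < e \<bullet> (A *v e)}"
  define H where "H = (\<lambda>\<epsilon>::real. {u \<in> sphere 0 1. 0 < \<epsilon> * (u \<bullet> e)})"
  have T_iff: "outer_square u \<in> T \<longleftrightarrow> u \<bullet> e \<noteq> 0" if "norm u = 1" for u
  proof -
    have "e \<bullet> (outer_square u *v e) = (u \<bullet> e)\<^sup>2"
      by (simp add: outer_square_mult power2_eq_square inner_commute[of e u])
    moreover have "outer_square u \<in> ?S"
      using that by auto
    ultimately show ?thesis
      by (simp add: T_def)
  qed
  have contmul: "continuous_on UNIV (\<lambda>A :: real^3^3. A *v e)"
    by (intro linear_continuous_on linear_conv_bounded_linear[THEN iffD1] linearI)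
      (auto simp: matrix_vector_mult_add_rdistrib scaleR_matrix_vector_assoc)
  have openH: "openin (top_of_set (sphere 0 1)) (H \<epsilon>)" for \<epsilon>
  proof -
    have "open {u. 0 < \<epsilon> * (u \<bullet> e)}"
      by (intro open_Collect_less continuous_intros)
    moreover have "H \<epsilon> = sphere 0 1 \<inter> {u. 0 < \<epsilon> * (u \<bullet> e)}"
      by (auto simp: H_def)
    ultimately show ?thesis
      by (auto intro: openin_open_Int)
  qed
  have "open {A. 0 < e \<bullet> (A *v e)}"
    by (intro open_Collect_less continuous_intros contmul)
  moreover have "T = ?S \<inter> {A. 0 < e \<bullet> (A *v e)}"
    by (auto simp: T_def)
  ultimately have openT: "openin (top_of_set ?S) T"
    by (auto intro: openin_open_Int)
  have "x \<in> T"
    using e by (simp add: T_iff dot_square_norm)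
  have Un: "\<Union>{H 1, H (-1)} = sphere 0 1 \<inter> outer_square -` T"
    by (auto simp: H_def T_iff)
  have disj: "pairwise disjnt {H 1, H (-1)}"
    by (auto simp: pairwise_def disjnt_def H_def)
  have homeo: "\<exists>q. homeomorphism (H \<epsilon>) T outer_square q" if "\<epsilon> \<in> {1, -1}" for \<epsilon>
  proof -
    \<comment> \<open>The matrix of \<open>u\<close> sends \<open>e\<close> to \<open>u\<close>
      multiplied by \<open>u \<bullet> e\<close>. Normalizing gives \<open>u\<close> up to sign, and
      \<open>\<epsilon>\<close>, the sign of \<open>u \<bullet> e\<close> on the sheet, corrects
      it.\<close>
    define q where "q = (\<lambda>A :: real^3^3. (\<epsilon> / norm (A *v e)) *\<^sub>R (A *v e))"
    have qH: "q (outer_square u) = u" if "u \<in> H \<epsilon>" for u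
    proof -
      have n: "norm (outer_square u *v e) = \<epsilon> * (u \<bullet> e)" and "u \<bullet> e \<noteq> 0"
        using that \<open>\<epsilon> \<in> {1, -1}\<close> by (auto simp: outer_square_mult H_def)
      have "q (outer_square u) = (\<epsilon> / (\<epsilon> * (u \<bullet> e))) *\<^sub>R ((u \<bullet> e) *\<^sub>R u)"
        unfolding q_def n unfolding outer_square_mult by (rule refl)
      also have "\<dots> = u"
        using \<open>u \<bullet> e \<noteq> 0\<close> \<open>\<epsilon> \<in> {1, -1}\<close> by auto
      finally show ?thesis .
    qed
    have HT: "outer_square ` H \<epsilon> = T"
    proof
      show "outer_square ` H \<epsilon> \<subseteq> T"
        by (auto simp: H_def T_iff)
      show "T \<subseteq> outer_square ` H \<epsilon>"
      proof
        fix A assume "A \<in> T"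
        moreover from this obtain u where "norm u = 1" "A = outer_square u"
          by (auto simp: T_def)
        ultimately have u: "norm u = 1" "A = outer_square u" "u \<bullet> e \<noteq> 0"
          by (simp_all add: T_iff)
        have "outer_square (- u) = outer_square u"
          using outer_square_scaleR[of "-1" u] by simp
        moreover have "u \<in> H \<epsilon> \<or> - u \<in> H \<epsilon>"
          using u \<open>\<epsilon> \<in> {1, -1}\<close> by (auto simp: H_def)
        ultimately show "A \<in> outer_square ` H \<epsilon>"
          using u by (auto simp: image_iff intro: bexI[of _ u] bexI[of _ "- u"])
      qed
    qed
    have "A *v e \<noteq> 0" if "A \<in> T" for A
      using that by (auto simp: T_def)
    then have "continuous_on T q"
      unfolding q_def
      by (intro continuous_intros continuous_on_subset[OF contmul]) auto
    then have "homeomorphism (H \<epsilon>) T outer_square q"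
      using qH HT continuous_on_outer_square by (intro homeomorphismI) auto
    then show ?thesis
      by blast
  qed
  then have "\<forall>u\<in>{H 1, H (-1)}. \<exists>q. homeomorphism u T outer_square q"
    by (metis insert_iff singletonD)
  moreover have "\<forall>u\<in>{H 1, H (-1)}. openin (top_of_set (sphere 0 1)) u"
    using openH by (metis insert_iff singletonD)
  ultimately show "\<exists>T. x \<in> T \<and> openin (top_of_set ?S) T \<and>
      (\<exists>v. \<Union>v = sphere 0 1 \<inter> outer_square -` T \<and>
        (\<forall>u\<in>v. openin (top_of_set (sphere 0 1)) u) \<and> pairwise disjnt v \<and>
        (\<forall>u\<in>v. \<exists>q. homeomorphism u T outer_square q))"
    using openT \<open>x \<in> T\<close> Un disj by (intro exI[of _ T] conjI exI[of _ "{H 1, H (-1)}"])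
qed (auto intro: continuous_on_outer_square)

text \<open>A convex set is simply connected and locally path connected, so
  \<open>rp2_matrix \<circ> f\<close> lifts through the covering by the sphere.
  \<open>outer_square_unit_eqD\<close> then says that the lift spans the line
  \<open>f x\<close>.\<close>

lemma rp2_lift:
  fixes f :: "'c::real_normed_vector \<Rightarrow> rp2"
  assumes "convex U" "continuous_on U f"
  obtains g where "continuous_on U g" "\<And>x. norm (g x) = 1" "\<And>x. x \<in> U \<Longrightarrow> rp2_point (g x) = f x"
proof (cases "U = {}")
  case True
  then show ?thesis
    using that[of "\<lambda>_. axis 1 1"] by auto
next
  case False
  then obtain z where "z \<in> U"
    by auto
  have "continuous_on U (rp2_matrix \<circ> f)"
    using assms by (intro continuous_on_compose continuous_on_rp2_matrix)
  moreover have "rp2_matrix \<circ> f \<in> U \<rightarrow> outer_square ` sphere 0 1"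
    by (auto simp: rp2_matrix_def)
  moreover have "rp2_unit (f z) \<in> sphere 0 1"
    by (simp add: dist_norm)
  moreover have "(rp2_matrix \<circ> f) z = outer_square (rp2_unit (f z))"
    by (simp add: rp2_matrix_def)
  moreover have "simply_connected U" "locally path_connected U"
    using \<open>convex U\<close> by (auto intro: convex_imp_simply_connected convex_imp_locally_path_connected)
  ultimately obtain g where g: "continuous_on U g" "g \<in> U \<rightarrow> sphere 0 1"
      "\<And>y. y \<in> U \<Longrightarrow> outer_square (g y) = (rp2_matrix \<circ> f) y"
    using covering_space_lift_strong[OF covering_space_outer_square, of "rp2_unit (f z)" z U "rp2_matrix \<circ> f"]
      \<open>z \<in> U\<close> by (metis (no_types, lifting))
  \<comment> \<open>Outside \<open>U\<close> any unit vector will do; with this default the norm is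
    1 for every argument, without a side condition.\<close>
  define g' where "g' = (\<lambda>x. if x \<in> U then g x else axis 1 1)"
  have "continuous_on U g'"
    using g(1) by (rule continuous_on_eq) (simp add: g'_def)
  moreover have "norm (g' x) = 1" for x
    using g(2) by (auto simp: g'_def)
  moreover have "rp2_point (g' x) = f x" if "x \<in> U" for x
    using outer_square_unit_eqD[of "g x" "rp2_unit (f x)"] g(2) g(3)[OF that] that
    by (auto simp: g'_def rp2_matrix_def Pi_iff)
  ultimately show ?thesis
    using that by blast
qed

text \<open>Over a fixed line a unit lift takes only two values, and a connected finite set has at
  most one point.\<close>

lemma rp2_lift_constant:
  fixes g :: "'c::topological_space \<Rightarrow> real^3"
  assumes "connected T" "continuous_on T g" "\<And>x. norm (g x) = 1"
    and "\<And>x. x \<in> T \<Longrightarrow> rp2_point (g x) = L" and "x \<in> T" "y \<in> T"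
  shows "g x = g y"
proof -
  let ?e = "rp2_unit L"
  have pm: "g z = ?e \<or> g z = - ?e" if z: "z \<in> T" for z
  proof -
    have "g z \<noteq> 0"
      using assms(3)[of z] by auto
    then obtain c where "g z = c *\<^sub>R ?e"
      using rp2_unit_point[of "g z"] assms(4)[OF z] by auto
    moreover from this have "\<bar>c\<bar> = 1"
      using assms(3)[of z] by simp
    ultimately show ?thesis
      by (cases "c \<ge> 0") auto
  qed
  have "g ` T \<subseteq> {?e, - ?e}"
    using pm by blast
  then have "finite (g ` T)"
    by (rule finite_subset) simp
  moreover have "connected (g ` T)"
    using assms by (intro connected_continuous_image)
  ultimately have "g ` T = {} \<or> (\<exists>a. g ` T = {a})"
    using connected_finite_iff_sing[of "g ` T"] by simp
  then obtain a where "g ` T = {a}"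
    using assms(5) by auto
  then have "g z = a" if "z \<in> T" for z
    using that by blast
  then show ?thesis
    using assms(5,6) by simp
qed

subsection \<open>Homotopies of three-strand braids\<close>

lemma config_space_2_iff: "x \<in> config_space \<longleftrightarrow> x $ 1 \<noteq> x $ (2::2)"
  by (auto simp: config_space_def inj_def forall_2)

lemma config_space_3_iff:
  "x \<in> config_space \<longleftrightarrow> x $ 1 \<noteq> x $ (2::3) \<and> x $ 1 \<noteq> x $ 3 \<and> x $ 2 \<noteq> x $ 3"
  by (auto simp: config_space_def inj_def forall_3)

definition lines :: "real^3 \<Rightarrow> real^3 \<Rightarrow> real^3 \<Rightarrow> rp2^3" where
  "lines u v w = (\<chi> i. if i = 1 then rp2_point u else if i = 2 then rp2_point v else rp2_point w)"

text \<open>The strands are recorded by paths of homogeneous coordinates. One path of configurations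
  has several such descriptions, differing by signs; this freedom is used to make the vectors fit
  when braids are joined.\<close>

definition braid :: "(real \<Rightarrow> real^3) \<Rightarrow> (real \<Rightarrow> real^3) \<Rightarrow> (real \<Rightarrow> real^3) \<Rightarrow> real \<Rightarrow> rp2^3" where
  "braid u v w = (\<lambda>t. lines (u t) (v t) (w t))"

definition det3 :: "real^3 \<Rightarrow> real^3 \<Rightarrow> real^3 \<Rightarrow> real" where
  "det3 u v w = cross3 u v \<bullet> w"

lemma lines_component [simp]:
  "lines u v w $ 1 = rp2_point u" "lines u v w $ 2 = rp2_point v" "lines u v w $ 3 = rp2_point w"
  by (simp_all add: lines_def)

lemma lines_scaleR: "c \<noteq> 0 \<Longrightarrow> lines u v (c *\<^sub>R w) = lines u v w"
  unfolding lines_def by (subst rp2_point_scaleR) simp_all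

lemma lines_in_config_space:
  assumes "cross3 u v \<noteq> 0" "cross3 u w \<noteq> 0" "cross3 v w \<noteq> 0"
  shows "lines u v w \<in> config_space"
proof -
  have "u \<noteq> 0" "v \<noteq> 0" "w \<noteq> 0"
    using assms by auto
  then show ?thesis
    using assms by (simp add: config_space_3_iff rp2_point_eq_iff)
qed

lemma continuous_on_lines:
  assumes "continuous_on S u" "continuous_on S v" "continuous_on S w"
    and "\<And>x. x \<in> S \<Longrightarrow> u x \<noteq> 0" "\<And>x. x \<in> S \<Longrightarrow> v x \<noteq> 0" "\<And>x. x \<in> S \<Longrightarrow> w x \<noteq> 0"
  shows "continuous_on S (\<lambda>x. lines (u x) (v x) (w x))"
  unfolding lines_def
proof (intro continuous_on_vec_lambda)
  fix i :: 3
  show "continuous_on S (\<lambda>x. if i = 1 then rp2_point (u x) else if i = 2 then rp2_point (v x)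
      else rp2_point (w x))"
    by (cases "i = 1"; cases "i = 2"; simp add: continuous_on_rp2_point_compose assms)
qed

text \<open>Cramer's rule: the determinants on the left are the coordinates of \<open>w\<close> in
  the frame \<open>u\<close>, \<open>v\<close>, \<open>m\<close>, multiplied by the determinant of
  the frame. As points are lines, that common factor is harmless and no division is made.\<close>

lemma cramer3:
  "det3 w v m *\<^sub>R u + det3 u w m *\<^sub>R v + det3 u v w *\<^sub>R m = det3 u v m *\<^sub>R w"
  by (simp add: det3_def cross3_simps forall_3)

lemma continuous_on_det3 [continuous_intros]:
  fixes f g h :: "'a::t2_space \<Rightarrow> real^3"
  assumes "continuous_on S f" "continuous_on S g" "continuous_on S h"
  shows "continuous_on S (\<lambda>x. det3 (f x) (g x) (h x))"
  unfolding det3_def by (intro continuous_intros continuous_on_cross assms)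

text \<open>The condition on frame coordinates for a vector to be a multiple neither of the first
  nor of the second frame vector, that is, for the third point to avoid the other two.\<close>

definition off_axes :: "real \<Rightarrow> real \<Rightarrow> real \<Rightarrow> bool" where
  "off_axes x y z \<longleftrightarrow> z \<noteq> 0 \<or> (x \<noteq> 0 \<and> y \<noteq> 0)"

text \<open>Pairing each cross product with two frame vectors returns a coordinate times the
  determinant of the frame, up to sign; under \<open>off_axes\<close> one of the two values is not
  0.\<close>

lemma cross3_frame_nonzero:
  assumes "det3 u v m \<noteq> 0" "off_axes x y z"
  shows "cross3 u (x *\<^sub>R u + y *\<^sub>R v + z *\<^sub>R m) \<noteq> 0"
    and "cross3 v (x *\<^sub>R u + y *\<^sub>R v + z *\<^sub>R m) \<noteq> 0"
proof -
  let ?w = "x *\<^sub>R u + y *\<^sub>R v + z *\<^sub>R m"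
  have "cross3 u ?w \<bullet> m = y * det3 u v m" "cross3 u ?w \<bullet> v = - z * det3 u v m"
      "cross3 v ?w \<bullet> m = - x * det3 u v m" "cross3 v ?w \<bullet> u = z * det3 u v m"
    by (simp_all add: det3_def cross3_simps)
  then show "cross3 u ?w \<noteq> 0" "cross3 v ?w \<noteq> 0"
    using assms unfolding off_axes_def by (metis inner_zero_left mult_eq_0_iff neg_equal_0_iff_equal)+
qed

lemma lines_frame_in_config_space:
  assumes "det3 u v m \<noteq> 0" "off_axes x y z"
  shows "lines u v (x *\<^sub>R u + y *\<^sub>R v + z *\<^sub>R m) \<in> config_space"
proof (rule lines_in_config_space)
  show "cross3 u v \<noteq> 0"
    using assms by (auto simp: det3_def)
qed (use cross3_frame_nonzero[OF assms] in auto)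

text \<open>A sign test for a whole segment of coordinates to stay off the axes. Either the third
  coordinate keeps a strict sign, or the first two start away from 0 and do not change sign. In the
  second case they may reach 0 only at the end, where \<open>off_axes\<close> is required
  separately.\<close>

definition segment_off_axes :: "real \<Rightarrow> real \<Rightarrow> real \<Rightarrow> real \<Rightarrow> real \<Rightarrow> real \<Rightarrow> bool" where
  "segment_off_axes x0 y0 z0 x1 y1 z1 \<longleftrightarrow> 0 < z0 * z1 \<or>
     (x0 \<noteq> 0 \<and> y0 \<noteq> 0 \<and> 0 \<le> x0 * x1 \<and> 0 \<le> y0 * y1 \<and> off_axes x1 y1 z1)"

text \<open>Multiplied by \<open>a\<close>, the combination is a positive number plus a nonnegative
  one.\<close>

lemma convex_combination_nonzero:
  fixes a b r :: real
  assumes "a \<noteq> 0" "0 \<le> a * b" "0 \<le> r" "r < 1"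
  shows "(1 - r) * a + r * b \<noteq> 0"
proof -
  have "0 < a * a"
    using \<open>a \<noteq> 0\<close> by (auto simp: zero_less_mult_iff)
  then have "0 < (1 - r) * (a * a)" "0 \<le> r * (a * b)"
    using assms by simp_all
  then have "0 < (1 - r) * (a * a) + r * (a * b)"
    by simp
  also have "\<dots> = a * ((1 - r) * a + r * b)"
    by (simp add: algebra_simps)
  finally show ?thesis
    by auto
qed

lemma segment_off_axesD:
  assumes "segment_off_axes x0 y0 z0 x1 y1 z1" "0 \<le> r" "r \<le> 1"
  shows "off_axes ((1 - r) * x0 + r * x1) ((1 - r) * y0 + r * y1) ((1 - r) * z0 + r * z1)"
proof (cases "r = 1")
  case True
  then show ?thesis
    using assms by (auto simp: segment_off_axes_def off_axes_def)
next
  case False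
  then have "r < 1"
    using assms by simp
  then show ?thesis
    using assms convex_combination_nonzero[of z0 z1 r]
      convex_combination_nonzero[of x0 x1 r] convex_combination_nonzero[of y0 y1 r]
    by (cases "z0 = 0") (auto simp: segment_off_axes_def off_axes_def)
qed

text \<open>The third strand is moved along segments, in coordinates with respect to the moving frame
  \<open>u\<close>, \<open>v\<close>, \<open>m\<close>.\<close>

lemma homotopic_paths_braid:
  fixes u v m w0 w1 :: "real \<Rightarrow> real^3"
  assumes cont: "continuous_on {0..1} u" "continuous_on {0..1} v" "continuous_on {0..1} m"
    and det: "\<And>t. t \<in> {0..1} \<Longrightarrow> det3 (u t) (v t) (m t) \<noteq> 0"
    and k: "path k0" "path_image k0 \<subseteq> {0..1}" "path k1" "path_image k1 \<subseteq> {0..1}"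
    and w: "path w0" "path w1"
    and ends: "k0 0 = k1 0" "w0 0 = w1 0" "k0 1 = k1 1" "w0 1 = w1 1"
    and seg: "\<And>t. t \<in> {0..1} \<Longrightarrow> segment_off_axes
      (det3 (w0 t) (v (k0 t)) (m (k0 t))) (det3 (u (k0 t)) (w0 t) (m (k0 t)))
      (det3 (u (k0 t)) (v (k0 t)) (w0 t))
      (det3 (w1 t) (v (k1 t)) (m (k1 t))) (det3 (u (k1 t)) (w1 t) (m (k1 t)))
      (det3 (u (k1 t)) (v (k1 t)) (w1 t))"
  shows "homotopic_paths config_space (braid (u \<circ> k0) (v \<circ> k0) w0) (braid (u \<circ> k1) (v \<circ> k1) w1)"
proof -
  let ?Q = "{0..1} \<times> {0..1} :: (real \<times> real) set"
  define x0 y0 z0 where "x0 = (\<lambda>t. det3 (w0 t) (v (k0 t)) (m (k0 t)))"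
    and "y0 = (\<lambda>t. det3 (u (k0 t)) (w0 t) (m (k0 t)))"
    and "z0 = (\<lambda>t. det3 (u (k0 t)) (v (k0 t)) (w0 t))"
  define x1 y1 z1 where "x1 = (\<lambda>t. det3 (w1 t) (v (k1 t)) (m (k1 t)))"
    and "y1 = (\<lambda>t. det3 (u (k1 t)) (w1 t) (m (k1 t)))"
    and "z1 = (\<lambda>t. det3 (u (k1 t)) (v (k1 t)) (w1 t))"
  \<comment> \<open>Both braids run through the same first two strands, with time changes
    \<open>k0\<close> and \<open>k1\<close>. The time changes are interpolated too, and remain in
    \<open>{0..1}\<close> by convexity.\<close>
  define \<kappa> where "\<kappa> = (\<lambda>(r, t). (1 - r) * k0 t + r * k1 t)"
  define X Y Z where "X = (\<lambda>(r, t). (1 - r) * x0 t + r * x1 t)"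
    and "Y = (\<lambda>(r, t). (1 - r) * y0 t + r * y1 t)"
    and "Z = (\<lambda>(r, t). (1 - r) * z0 t + r * z1 t)"
  \<comment> \<open>The interpolated coordinates are read in the frame at the interpolated time, so
    that \<open>off_axes\<close> keeps the third point away from the first two.\<close>
  define W where "W = (\<lambda>q. X q *\<^sub>R u (\<kappa> q) + Y q *\<^sub>R v (\<kappa> q) + Z q *\<^sub>R m (\<kappa> q))"
  define h where "h = (\<lambda>q. lines (u (\<kappa> q)) (v (\<kappa> q)) (W q))"
  have k01: "k0 t \<in> {0..1}" "k1 t \<in> {0..1}" if "t \<in> {0..1}" for t
    using k that unfolding path_image_def by blast+
  have \<kappa>01: "\<kappa> q \<in> {0..1}" if Q: "q \<in> ?Q" for q
  proof -
    obtain r t where q: "q = (r, t)" "r \<in> {0..1}" "t \<in> {0..1}"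
      using Q by auto
    then show ?thesis
      using convexD_alt[OF convex_real_interval(5) k01[OF q(3)], of r] by (simp add: \<kappa>_def)
  qed
  have frame: "det3 (u (\<kappa> q)) (v (\<kappa> q)) (m (\<kappa> q)) \<noteq> 0" if "q \<in> ?Q" for q
    using det \<kappa>01[OF that] by blast
  have off: "off_axes (X q) (Y q) (Z q)" if Q: "q \<in> ?Q" for q
  proof -
    obtain r t where q: "q = (r, t)" "r \<in> {0..1}" "t \<in> {0..1}"
      using Q by auto
    show ?thesis
      using segment_off_axesD[OF seg[OF q(3)], of r] q
      by (simp add: X_def Y_def Z_def x0_def y0_def z0_def x1_def y1_def z1_def)
  qed
  have contk: "continuous_on {0..1} (\<lambda>t. g (j t))"
    if "continuous_on {0..1} g" "j \<in> {k0, k1}" for g :: "real \<Rightarrow> real^3" and j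
    by (rule continuous_on_compose2[OF that(1)]) (use k that(2) in \<open>auto simp: path_def path_image_def\<close>)
  have cont01: "continuous_on {0..1} x0" "continuous_on {0..1} y0" "continuous_on {0..1} z0"
      "continuous_on {0..1} x1" "continuous_on {0..1} y1" "continuous_on {0..1} z1"
    unfolding x0_def y0_def z0_def x1_def y1_def z1_def
    using w by (auto intro!: continuous_on_det3 contk cont simp: path_def)
  have contQ: "continuous_on ?Q (\<lambda>(r, t). (1 - r) * f t + r * g t)"
    if "continuous_on {0..1} f" "continuous_on {0..1} g" for f g :: "real \<Rightarrow> real"
    unfolding case_prod_beta
    by (intro continuous_intros continuous_on_compose2[OF that(1)] continuous_on_compose2[OF that(2)]) auto
  have cont\<kappa>: "continuous_on ?Q \<kappa>" and contXYZ: "continuous_on ?Q X" "continuous_on ?Q Y" "continuous_on ?Q Z"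
    unfolding \<kappa>_def X_def Y_def Z_def using k cont01 by (auto intro!: contQ simp: path_def)
  have contg: "continuous_on ?Q (\<lambda>q. g (\<kappa> q))" if "continuous_on {0..1} g" for g :: "real \<Rightarrow> real^3"
    by (rule continuous_on_compose2[OF that cont\<kappa>]) (use \<kappa>01 in blast)
  have contW: "continuous_on ?Q W"
    unfolding W_def by (intro continuous_intros contXYZ contg cont)
  have conth: "continuous_on ?Q h"
    unfolding h_def
  proof (rule continuous_on_lines)
    fix q assume Q: "q \<in> ?Q"
    show "u (\<kappa> q) \<noteq> 0" "v (\<kappa> q) \<noteq> 0" "W q \<noteq> 0"
      using frame[OF Q] cross3_frame_nonzero[OF frame[OF Q] off[OF Q]] by (auto simp: det3_def W_def)
  qed (intro contg cont contW)+
  have him: "h \<in> ?Q \<rightarrow> config_space"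
    unfolding h_def W_def by (intro Pi_I lines_frame_in_config_space frame off)
  \<comment> \<open>By Cramer's rule \<open>W\<close> is here \<open>w0 t\<close> times the
    determinant of the frame, which represents the same point.\<close>
  have h0: "h (0, t) = braid (u \<circ> k0) (v \<circ> k0) w0 t" if "t \<in> {0..1}" for t
    using det[OF k01(1)[OF that]] lines_scaleR cramer3[of "w0 t"]
    by (simp add: h_def W_def \<kappa>_def X_def Y_def Z_def x0_def y0_def z0_def braid_def)
  have h1: "h (1, t) = braid (u \<circ> k1) (v \<circ> k1) w1 t" if "t \<in> {0..1}" for t
    using det[OF k01(2)[OF that]] lines_scaleR cramer3[of "w1 t"]
    by (simp add: h_def W_def \<kappa>_def X_def Y_def Z_def x1_def y1_def z1_def braid_def)
  \<comment> \<open>At both end times the two braids have the same time and the same third vector,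
    so the interpolation is constant in \<open>r\<close>.\<close>
  have hr: "h (r, t) = h (0, t)" if "t \<in> {0, 1}" for r t
  proof -
    have "k1 t = k0 t" "w1 t = w0 t"
      using that ends by auto
    then show ?thesis
      by (simp add: h_def W_def \<kappa>_def X_def Y_def Z_def x0_def y0_def z0_def x1_def y1_def z1_def
          algebra_simps)
  qed
  have "h (r, 0) = braid (u \<circ> k0) (v \<circ> k0) w0 0" "h (r, 1) = braid (u \<circ> k0) (v \<circ> k0) w0 1" for r
    using hr[of 0 r] hr[of 1 r] h0[of 0] h0[of 1] by auto
  then show ?thesis
    unfolding homotopic_paths using conth him h0 h1
    by (intro exI[of _ h]) (auto simp: pathstart_def pathfinish_def)
qed

lemma braid_join: "braid u v w +++ braid u' v' w' = braid (u +++ u') (v +++ v') (w +++ w')"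
  by (auto simp: braid_def joinpaths_def)

lemma reversepath_braid: "reversepath (braid u v w) = braid (reversepath u) (reversepath v) (reversepath w)"
  by (auto simp: braid_def reversepath_def)

subsection \<open>The generators in terms of the cross product section\<close>

definition affine_vec :: "real \<Rightarrow> real^3" where
  "affine_vec a = vector [a, 0, 1]"

definition band_vec :: "real \<Rightarrow> real \<Rightarrow> real^3" where
  "band_vec a t = vector [a * cos (pi * t) - sin (pi * t), sin (pi * t) * cos (pi * t), cos (pi * t)]"

definition vertical_vec :: "real^3" where
  "vertical_vec = vector [0, 1, 0]"

lemma trig_quadrants:
  fixes t :: real
  shows "0 < t \<Longrightarrow> t < 1 \<Longrightarrow> 0 < sin (pi * t)"
    and "0 < t \<Longrightarrow> t < 1 / 2 \<Longrightarrow> 0 < cos (pi * t)"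
    and "1 / 2 < t \<Longrightarrow> t < 1 \<Longrightarrow> cos (pi * t) < 0"
    and "t = 1 / 2 \<Longrightarrow> cos (pi * t) = 0"
proof -
  show "cos (pi * t) = 0" if "t = 1 / 2"
    unfolding that by simp
  show "0 < sin (pi * t)" if "0 < t" "t < 1"
    using that by (intro sin_gt_zero) auto
  show "0 < cos (pi * t)" if "0 < t" "t < 1 / 2"
    using that mult_strict_left_mono[of t "1 / 2" pi] by (intro cos_gt_zero) auto
  show "cos (pi * t) < 0" if "1 / 2 < t" "t < 1"
  proof -
    have "0 < cos (pi * (1 - t))"
      using that mult_strict_left_mono[of "1 - t" "1 / 2" pi] by (intro cos_gt_zero) auto
    also have "pi * (1 - t) = pi - pi * t"
      by (simp add: algebra_simps)
    finally show ?thesis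
      by simp
  qed
qed

lemma unit_interval_cases:
  assumes "t \<in> {0..1::real}"
  obtains "t = 0" | "0 < t" "t < 1 / 2" | "t = 1 / 2" | "1 / 2 < t" "t < 1" | "t = 1"
  using assms by (cases "t = 0"; cases "t = 1 / 2"; cases "t = 1"; fastforce)

text \<open>The lift of the band loop ends at the opposite of its initial vector. This is the source
  of the minus signs in the concatenations below.\<close>

lemma band_vec_ends [simp]:
  "band_vec a 0 = affine_vec a" "band_vec a 1 = - affine_vec a"
  by (simp_all add: band_vec_def affine_vec_def vec_eq_iff forall_3)

lemma affine_vec_nonzero [simp]: "affine_vec a \<noteq> 0"
  by (simp add: affine_vec_def vec_eq_iff forall_3)

lemma band_vec_nonzero [simp]: "band_vec a t \<noteq> 0"
proof
  assume "band_vec a t = 0"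
  then have "cos (pi * t) = 0" "sin (pi * t) = 0"
    by (auto simp: band_vec_def vec_eq_iff forall_3)
  then show False
    using sin_cos_squared_add[of "pi * t"] by simp
qed

lemma continuous_on_vector_3:
  fixes f g h :: "'a::topological_space \<Rightarrow> real"
  assumes "continuous_on S f" "continuous_on S g" "continuous_on S h"
  shows "continuous_on S (\<lambda>x. vector [f x, g x, h x] :: real^3)"
proof -
  have eq: "(\<lambda>x. vector [f x, g x, h x] :: real^3) =
      (\<lambda>x. \<chi> i. if i = 1 then f x else if i = 2 then g x else h x)"
    by (simp add: fun_eq_iff vec_eq_iff forall_3)
  show ?thesis
    unfolding eq
  proof (rule continuous_on_vec_lambda)
    show "continuous_on S (\<lambda>x. if i = 1 then f x else if i = 2 then g x else h x)" for i :: 3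
      by (cases "i = 1"; cases "i = 2"; simp add: assms)
  qed
qed

lemma continuous_on_band_vec [continuous_intros]: "continuous_on S (band_vec a)"
  unfolding band_vec_def by (intro continuous_on_vector_3 continuous_intros)

lemma det3_affine_vertical:
  "det3 w (affine_vec b) (d *\<^sub>R vertical_vec) = d * (b * w $ 3 - w $ 1)"
  "det3 (affine_vec a) w (d *\<^sub>R vertical_vec) = d * (w $ 1 - a * w $ 3)"
  "det3 (affine_vec a) (affine_vec b) w = (b - a) * w $ 2"
  by (simp_all add: det3_def affine_vec_def vertical_vec_def cross3_simps)

lemma vec_components [simp]:
  "affine_vec a $ 1 = a" "affine_vec a $ 2 = 0" "affine_vec a $ 3 = 1"
  "vertical_vec $ 1 = 0" "vertical_vec $ 2 = 1" "vertical_vec $ 3 = 0"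
  "band_vec a t $ 1 = a * cos (pi * t) - sin (pi * t)"
  "band_vec a t $ 2 = sin (pi * t) * cos (pi * t)"
  "band_vec a t $ 3 = cos (pi * t)"
  by (simp_all add: affine_vec_def vertical_vec_def band_vec_def)

lemma vertical_vec_inner [simp]: "vertical_vec \<bullet> w = w $ 2"
  by (simp add: vertical_vec_def inner_vec_def sum_3)

lemma segment_off_axes_refl: "x \<noteq> 0 \<Longrightarrow> y \<noteq> 0 \<Longrightarrow> segment_off_axes x y z x y z'"
  by (simp add: segment_off_axes_def off_axes_def)

text \<open>If the product vanishes, one of sine and cosine is 0 and the other is 1 or -1. It
  follows that the cross product of a band vector with an affine vector is never 0.\<close>

lemma sin_cos_linear_nonzero:
  fixes d e x :: real
  assumes "sin x * cos x = 0" "d \<noteq> 0" "e \<noteq> 0"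
  shows "cos x * d + e * sin x \<noteq> 0"
  using assms sin_zero_abs_cos_one[of x] by auto

text \<open>The first two points rest, so the frame is constant. The vector path goes up from the
  axis to the vertical direction and returns from below, which is the upward leg followed by the
  reversed downward leg.\<close>

lemma homotopic_rho3:
  assumes "a1 < a2" "a2 < a3"
  shows "homotopic_paths config_space
    (braid (\<lambda>_. affine_vec a1) (\<lambda>_. affine_vec a2) (band_vec a3))
    (braid (\<lambda>_. affine_vec a1) (\<lambda>_. affine_vec a2)
      (linepath (affine_vec a3) ((a2 - a1) *\<^sub>R vertical_vec) +++
       linepath ((a2 - a1) *\<^sub>R vertical_vec) (- affine_vec a3)))"
proof -
  \<comment> \<open>With this factor \<open>d *\<^sub>R vertical_vec\<close> equals the cross
    product of the two affine vectors.\<close>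
  define d where "d = a2 - a1"
  have "0 < d"
    using assms by (simp add: d_def)
  let ?w = "linepath (affine_vec a3) (d *\<^sub>R vertical_vec) +++
       linepath (d *\<^sub>R vertical_vec) (- affine_vec a3)"
  have "homotopic_paths config_space
    (braid ((\<lambda>_::real. affine_vec a1) \<circ> (\<lambda>_. 0::real)) ((\<lambda>_::real. affine_vec a2) \<circ> (\<lambda>_. 0::real)) (band_vec a3))
    (braid ((\<lambda>_::real. affine_vec a1) \<circ> (\<lambda>_. 0::real)) ((\<lambda>_::real. affine_vec a2) \<circ> (\<lambda>_. 0::real)) ?w)"
  proof (rule homotopic_paths_braid[where u = "\<lambda>_. affine_vec a1" and v = "\<lambda>_. affine_vec a2"
        and m = "\<lambda>_. 1 *\<^sub>R vertical_vec" and ?k0.0 = "\<lambda>_. 0" and ?k1.0 = "\<lambda>_. 0"])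
    show "det3 (affine_vec a1) (affine_vec a2) (1 *\<^sub>R vertical_vec) \<noteq> 0"
      using assms by (simp add: det3_affine_vertical del: scaleR_one)
    show "path (band_vec a3)"
      unfolding path_def by (rule continuous_on_band_vec)
    show "path ?w"
      by simp
    show "band_vec a3 0 = ?w 0" "band_vec a3 1 = ?w 1"
      by (simp_all add: joinpaths_def linepath_def)
    fix t :: real assume t: "t \<in> {0..1}"
    show "segment_off_axes
        (det3 (band_vec a3 t) (affine_vec a2) (1 *\<^sub>R vertical_vec))
        (det3 (affine_vec a1) (band_vec a3 t) (1 *\<^sub>R vertical_vec))
        (det3 (affine_vec a1) (affine_vec a2) (band_vec a3 t))
        (det3 (?w t) (affine_vec a2) (1 *\<^sub>R vertical_vec))
        (det3 (affine_vec a1) (?w t) (1 *\<^sub>R vertical_vec))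
        (det3 (affine_vec a1) (affine_vec a2) (?w t))"
    \<comment> \<open>In the open first half both third coordinates are positive. In the second half
      they no longer agree in sign; there the first coordinates are at least 0 and the second ones
      at most 0, strictly so for the band loop.\<close>
    proof (cases "t < 1 / 2")
      case True
      show ?thesis
      proof (cases "t = 0")
        case True
        then show ?thesis
          using assms by (simp add: det3_affine_vertical segment_off_axes_def off_axes_def
              joinpaths_def linepath_def del: scaleR_one)
      next
        case False
        then have "0 < sin (pi * t)" "0 < cos (pi * t)" "0 < t"
          using t True trig_quadrants[of t] by auto
        then show ?thesis
          using True assms \<open>0 < d\<close> by (simp add: det3_affine_vertical segment_off_axes_def
              joinpaths_def linepath_def del: scaleR_one)
      qed
    next
      case False
      define c s where "c = cos (pi * t)" and "s = sin (pi * t)"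
      have "c \<le> 0 \<and> 0 \<le> s \<and> (c < 0 \<or> 0 < s)"
        by (cases rule: unit_interval_cases[OF t])
          (use False trig_quadrants[of t] in \<open>auto simp: c_def s_def\<close>)
      then have cs: "c \<le> 0" "0 \<le> s" "c < 0 \<or> 0 < s"
        by auto
      \<comment> \<open>At \<open>t = 1 / 2\<close> the join still takes its first branch; both
        branches give the same vector there.\<close>
      have w: "?w t = (2 - 2 * t) *\<^sub>R (d *\<^sub>R vertical_vec) - (2 * t - 1) *\<^sub>R affine_vec a3"
      proof (cases "t = 1 / 2")
        case True
        show ?thesis
          unfolding True by (simp add: joinpaths_def linepath_def)
      next
        case False
        with \<open>\<not> t < 1 / 2\<close> show ?thesis
          by (simp add: joinpaths_def linepath_def)
      qed
      have "(a3 - a2) * c \<le> 0" "c < 0 \<Longrightarrow> (a3 - a2) * c < 0"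
          "(a3 - a1) * c \<le> 0" "c < 0 \<Longrightarrow> (a3 - a1) * c < 0"
        using cs assms by (auto intro: mult_nonneg_nonpos mult_pos_neg)
      then have pos: "0 < s - (a3 - a2) * c" "(a3 - a1) * c - s < 0"
        using cs by linarith+
      have "0 \<le> (s - (a3 - a2) * c) * ((2 * t - 1) * (a3 - a2))"
          "0 \<le> ((a3 - a1) * c - s) * ((2 * t - 1) * (a1 - a3))"
        using pos assms False by (auto intro!: mult_nonneg_nonneg mult_nonpos_nonpos mult_nonneg_nonpos)
      moreover have "off_axes ((2 * t - 1) * (a3 - a2)) ((2 * t - 1) * (a1 - a3)) ((a2 - a1) * ((2 - 2 * t) * d))"
        using assms \<open>0 < d\<close> by (auto simp: off_axes_def)
      ultimately have "segment_off_axes (s - (a3 - a2) * c) ((a3 - a1) * c - s) z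
          ((2 * t - 1) * (a3 - a2)) ((2 * t - 1) * (a1 - a3)) ((a2 - a1) * ((2 - 2 * t) * d))" for z
        using pos by (simp add: segment_off_axes_def)
      then show ?thesis
        unfolding w det3_affine_vertical by (simp add: c_def s_def algebra_simps)
    qed
  qed (auto simp: path_def path_image_def)
  then show ?thesis
    by (simp add: d_def o_def)
qed

text \<open>The second braid is the downward leg, the section over the loop of the first point, and
  the reversed upward leg. The section carries a minus sign because the downward leg ends at the
  negative vertical vector; along the loop it turns into the positive one, from which the upward leg
  is reversed.\<close>

lemma homotopic_rho1:
  assumes "a1 < a2" "a2 < a3"
  shows "homotopic_paths config_space
    (braid (band_vec a1) (\<lambda>_. affine_vec a2) (\<lambda>_. affine_vec a3))
    (braid ((\<lambda>_. affine_vec a1) +++ (band_vec a1 +++ (\<lambda>_. - affine_vec a1))) (\<lambda>_. affine_vec a2)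
      (linepath (affine_vec a3) (- ((a2 - a1) *\<^sub>R vertical_vec)) +++
       ((\<lambda>t. - cross3 (band_vec a1 t) (affine_vec a2)) +++
        linepath ((a2 - a1) *\<^sub>R vertical_vec) (affine_vec a3))))"
proof -
  define d where "d = a2 - a1"
  have "0 < d" and a1: "a1 = a2 - d"
    using assms by (simp_all add: d_def)
  define n where "n = (\<lambda>t. cross3 (band_vec a1 t) (affine_vec a2))"
  \<comment> \<open>This is \<open>n\<close> with its last component replaced by 0. Then
    \<open>n t \<bullet> m t\<close> is still positive, while the second coordinate of
    \<open>affine_vec a3\<close> loses a term with the factor \<open>a2 * a3\<close>, whose sign is
    unknown.\<close>
  define m :: "real \<Rightarrow> real^3" where
    "m = (\<lambda>t. vector [sin (pi * t) * cos (pi * t), cos (pi * t) * d + sin (pi * t), 0])"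
  define w :: "real \<Rightarrow> real^3" where
    "w = linepath (affine_vec a3) (- (d *\<^sub>R vertical_vec)) +++
      ((\<lambda>t. - n t) +++ linepath (d *\<^sub>R vertical_vec) (affine_vec a3))"
  \<comment> \<open>The time of the first two strands: at rest during the first leg, running during
    the section, at rest again during the last leg.\<close>
  define k :: "real \<Rightarrow> real" where "k = (\<lambda>_. 0) +++ ((\<lambda>t. t) +++ (\<lambda>_. 1))"
  have n_ends: "n 0 = d *\<^sub>R vertical_vec" "n 1 = - (d *\<^sub>R vertical_vec)"
    by (simp_all add: n_def d_def cross3_def vec_eq_iff forall_3)
  have m_ends: "m 0 = d *\<^sub>R vertical_vec" "m 1 = - (d *\<^sub>R vertical_vec)"
    by (simp_all add: m_def vec_eq_iff forall_3)
  have Z: "det3 (band_vec a1 t) (affine_vec a2) w = n t \<bullet> w" for t w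
    by (simp add: det3_def n_def)
  have nonzero: "sin (pi * t) * cos (pi * t) \<noteq> 0 \<or> cos (pi * t) * d + sin (pi * t) \<noteq> 0" for t
    using sin_cos_linear_nonzero[of "pi * t" d 1] \<open>0 < d\<close> by auto
  have n_eq: "n t = vector [sin (pi * t) * cos (pi * t), cos (pi * t) * d + sin (pi * t),
      - a2 * (sin (pi * t) * cos (pi * t))]" for t
    by (simp add: n_def d_def cross3_def vec_eq_iff forall_3 algebra_simps)
  have "n t \<noteq> 0" for t
    using nonzero[of t] by (auto simp: n_eq vec_eq_iff forall_3)
  then have nn: "0 < n t \<bullet> n t" for t
    by simp
  have "homotopic_paths config_space
    (braid (band_vec a1 \<circ> (\<lambda>t. t)) ((\<lambda>_. affine_vec a2) \<circ> (\<lambda>t. t)) (\<lambda>_. affine_vec a3))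
    (braid (band_vec a1 \<circ> k) ((\<lambda>_. affine_vec a2) \<circ> k) w)"
  proof (rule homotopic_paths_braid[where m = m])
    show "continuous_on {0..1} m"
      unfolding m_def by (intro continuous_on_vector_3 continuous_intros)
    show "det3 (band_vec a1 t) (affine_vec a2) (m t) \<noteq> 0" for t
    proof -
      have "n t \<bullet> m t = m t \<bullet> m t" "m t \<noteq> 0"
        using nonzero[of t] by (auto simp: n_eq m_def inner_vec_def sum_3 vec_eq_iff forall_3)
      then show ?thesis
        by (simp add: Z)
    qed
    have "path (\<lambda>t. - n t)"
      unfolding path_def n_def by (intro continuous_intros continuous_on_cross)
    moreover have "pathstart (\<lambda>t. - n t) = - (d *\<^sub>R vertical_vec)"
        "pathfinish (\<lambda>t. - n t) = d *\<^sub>R vertical_vec"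
      by (simp_all add: pathstart_def pathfinish_def n_ends)
    ultimately show "path w"
      by (simp add: w_def)
    show "path k"
      unfolding k_def
      by (intro path_join_imp) (auto simp: path_def pathstart_def pathfinish_def joinpaths_def)
    show "path_image k \<subseteq> {0..1}"
      by (auto simp: k_def path_image_def joinpaths_def)
    show "(0::real) = k 0" "affine_vec a3 = w 0" "(1::real) = k 1" "affine_vec a3 = w 1"
      by (simp_all add: k_def w_def joinpaths_def linepath_def)
    fix t :: real assume t: "t \<in> {0..1}"
    have x0: "det3 (affine_vec a3) (affine_vec a2) (m t) =
        - (a3 - a2) * (cos (pi * t) * d + sin (pi * t))"
      by (simp add: det3_def cross3_def inner_vec_def sum_3 m_def algebra_simps)
    have y0: "det3 (band_vec a1 t) (affine_vec a3) (m t) = (sin (pi * t) * cos (pi * t))\<^sup>2 +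
        (cos (pi * t) * d + sin (pi * t)) * (cos (pi * t) * (a3 - a1) + sin (pi * t))"
      by (simp add: det3_def cross3_def inner_vec_def sum_3 m_def power2_eq_square algebra_simps)
    have z0: "n t \<bullet> affine_vec a3 = (a3 - a2) * (sin (pi * t) * cos (pi * t))"
      by (simp add: n_eq inner_vec_def sum_3 algebra_simps)
    show "segment_off_axes (det3 (affine_vec a3) (affine_vec a2) (m t))
        (det3 (band_vec a1 t) (affine_vec a3) (m t)) (det3 (band_vec a1 t) (affine_vec a2) (affine_vec a3))
        (det3 (w t) (affine_vec a2) (m (k t))) (det3 (band_vec a1 (k t)) (w t) (m (k t)))
        (det3 (band_vec a1 (k t)) (affine_vec a2) (w t))"
    proof -
      \<comment> \<open>Up to time 1/2 the first coordinates are at most 0 and the second at least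
        0, strictly so for the fixed third point. Strictly between 1/2 and 1 both third coordinates
        are negative: they are those of \<open>affine_vec a3\<close>, of \<open>- n\<close>, and of
        the last leg. At time 1 the two vectors agree.\<close>
      consider "t \<le> 1 / 2" | "1 / 2 < t" "t < 1" | "t = 1"
        using t by fastforce
      then show ?thesis
      proof cases
        case 1
        have "0 \<le> cos (pi * t) \<and> 0 \<le> sin (pi * t) \<and> (0 < cos (pi * t) \<or> 0 < sin (pi * t))"
          by (cases rule: unit_interval_cases[OF t]) (use 1 trig_quadrants[of t] in auto)
        then have cs: "0 \<le> cos (pi * t)" "0 \<le> sin (pi * t)" "0 < cos (pi * t) \<or> 0 < sin (pi * t)"
          by auto
        have k: "k t = 0" and w: "w t = (1 - 2 * t) *\<^sub>R affine_vec a3 - (2 * t) *\<^sub>R (d *\<^sub>R vertical_vec)"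
          using 1 by (auto simp: k_def w_def joinpaths_def linepath_def)
        have pos: "0 < cos (pi * t) * d + sin (pi * t)" "0 < cos (pi * t) * (a3 - a1) + sin (pi * t)"
          using cs assms \<open>0 < d\<close> by (auto intro: add_pos_nonneg add_nonneg_pos)
        have x1: "det3 (w t) (affine_vec a2) (m (k t)) = - (d * (1 - 2 * t) * (a3 - a2))"
          and y1: "det3 (band_vec a1 (k t)) (w t) (m (k t)) = d * (1 - 2 * t) * (a3 - a1)"
          and z1: "n (k t) \<bullet> w t = - (2 * t * d * d)"
          unfolding k m_ends n_ends band_vec_ends det3_affine_vertical
          by (simp_all add: w algebra_simps)
        have "x0 < 0" "0 < y0" if "x0 = - (a3 - a2) * (cos (pi * t) * d + sin (pi * t))"
            "y0 = (sin (pi * t) * cos (pi * t))\<^sup>2 +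
              (cos (pi * t) * d + sin (pi * t)) * (cos (pi * t) * (a3 - a1) + sin (pi * t))" for x0 y0
          unfolding that using pos assms by (auto intro!: add_nonneg_pos mult_neg_pos)
        moreover have "- (d * (1 - 2 * t) * (a3 - a2)) \<le> 0" "0 \<le> d * (1 - 2 * t) * (a3 - a1)"
          using 1 assms \<open>0 < d\<close> by auto
        moreover have "off_axes (- (d * (1 - 2 * t) * (a3 - a2))) (d * (1 - 2 * t) * (a3 - a1)) (- (2 * t * d * d))"
          using assms \<open>0 < d\<close> by (auto simp: off_axes_def)
        ultimately show ?thesis
          unfolding Z x1 y1 z1 segment_off_axes_def using x0 y0
          by (metis less_imp_le less_irrefl mult_nonneg_nonneg mult_nonpos_nonpos)
      next
        case 2
        then have "n t \<bullet> affine_vec a3 < 0"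
          using assms trig_quadrants[of t] unfolding z0 by (auto intro!: mult_pos_neg)
        moreover have "n (k t) \<bullet> w t < 0"
        proof (cases "t \<le> 3 / 4")
          case True
          then have "w t = - n (k t)"
            using 2 by (simp add: k_def w_def joinpaths_def)
          then show ?thesis
            using nn by simp
        next
          case False
          define p where "p = 2 * (2 * t - 1) - 1"
          have "k t = 1" "w t = (1 - p) *\<^sub>R (d *\<^sub>R vertical_vec) + p *\<^sub>R affine_vec a3"
            using False 2 by (simp_all add: k_def w_def joinpaths_def linepath_def p_def)
          moreover have "p < 1"
            using 2 by (simp add: p_def)
          ultimately show ?thesis
            using \<open>0 < d\<close> by (simp add: n_ends)
        qed
        ultimately show ?thesis
          unfolding Z segment_off_axes_def by (simp add: mult_neg_neg)
      next
        case 3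
        then have "k t = t" "w t = affine_vec a3"
          by (simp_all add: k_def w_def joinpaths_def linepath_def)
        then show ?thesis
          using 3 assms \<open>0 < d\<close> x0 y0 by (auto intro!: segment_off_axes_refl)
      qed
    qed
  qed (auto simp: path_def path_image_def intro!: continuous_on_band_vec)
  moreover have "band_vec a1 \<circ> k = (\<lambda>_. affine_vec a1) +++ (band_vec a1 +++ (\<lambda>_. - affine_vec a1))"
    by (auto simp: k_def joinpaths_def)
  ultimately show ?thesis
    by (simp add: o_def w_def n_def d_def)
qed

text \<open>When the second point crosses infinity, at time 1/2, it lies on the axis, so the third
  coordinate of the fixed third point changes sign. The legs \<open>d\<close>,
  \<open>u\<^sup>-\<^sup>1\<close>, \<open>d\<close> make the comparison path cross the axis at the
  same moment: both third coordinates are negative before and positive after.\<close>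

lemma homotopic_rho2:
  assumes "a1 < a2" "a2 < a3"
  shows "homotopic_paths config_space
    (braid (\<lambda>_. affine_vec a1) (band_vec a2) (\<lambda>_. affine_vec a3))
    (braid (\<lambda>_. affine_vec a1)
      (((\<lambda>_. affine_vec a2) +++ (\<lambda>_. affine_vec a2)) +++
       ((\<lambda>_. affine_vec a2) +++ (band_vec a2 +++ (\<lambda>_. - affine_vec a2))))
      ((linepath (affine_vec a3) (- ((a2 - a1) *\<^sub>R vertical_vec)) +++
        linepath (- ((a2 - a1) *\<^sub>R vertical_vec)) (- affine_vec a3)) +++
       (linepath (- affine_vec a3) ((a2 - a1) *\<^sub>R vertical_vec) +++
        ((\<lambda>t. cross3 (affine_vec a1) (band_vec a2 t)) +++
         linepath (- ((a2 - a1) *\<^sub>R vertical_vec)) (affine_vec a3)))))"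
proof -
  define d where "d = a2 - a1"
  have "0 < d" and a2: "a2 = a1 + d"
    using assms by (simp_all add: d_def)
  define n where "n = (\<lambda>t. cross3 (affine_vec a1) (band_vec a2 t))"
  define w :: "real \<Rightarrow> real^3" where
    "w = (linepath (affine_vec a3) (- (d *\<^sub>R vertical_vec)) +++
        linepath (- (d *\<^sub>R vertical_vec)) (- affine_vec a3)) +++
       (linepath (- affine_vec a3) (d *\<^sub>R vertical_vec) +++
        (n +++ linepath (- (d *\<^sub>R vertical_vec)) (affine_vec a3)))"
  define k :: "real \<Rightarrow> real" where
    "k = ((\<lambda>_. 0) +++ (\<lambda>_. 0)) +++ ((\<lambda>_. 0) +++ ((\<lambda>t. t) +++ (\<lambda>_. 1)))"
  have n_ends: "n 0 = d *\<^sub>R vertical_vec" "n 1 = - (d *\<^sub>R vertical_vec)"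
    by (simp_all add: n_def d_def cross3_def vec_eq_iff forall_3)
  have Z: "det3 (affine_vec a1) (band_vec a2 t) w = n t \<bullet> w" for t w
    by (simp add: det3_def n_def)
  have nonzero: "sin (pi * t) * cos (pi * t) \<noteq> 0 \<or> cos (pi * t) * d - sin (pi * t) \<noteq> 0" for t
    using sin_cos_linear_nonzero[of "pi * t" d "- 1"] \<open>0 < d\<close> by auto
  have n_eq: "n t = vector [- (sin (pi * t) * cos (pi * t)), cos (pi * t) * d - sin (pi * t),
      a1 * (sin (pi * t) * cos (pi * t))]" for t
    by (simp add: n_def d_def cross3_def vec_eq_iff forall_3 algebra_simps)
  have n_nonzero: "n t \<noteq> 0" for t
    using nonzero[of t] by (auto simp: n_eq vec_eq_iff forall_3)
  then have nn: "0 < n t \<bullet> n t" for t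
    by simp
  have z0: "n t \<bullet> affine_vec a3 = - ((a3 - a1) * (sin (pi * t) * cos (pi * t)))" for t
    by (simp add: n_eq inner_vec_def sum_3 algebra_simps)
  have "homotopic_paths config_space
    (braid ((\<lambda>_. affine_vec a1) \<circ> (\<lambda>t. t)) (band_vec a2 \<circ> (\<lambda>t. t)) (\<lambda>_. affine_vec a3))
    (braid ((\<lambda>_. affine_vec a1) \<circ> k) (band_vec a2 \<circ> k) w)"
  \<comment> \<open>Here the cross product itself serves as third frame vector, since the first two
    coordinates are inspected only at the times 0, 1/2 and 1.\<close>
  proof (rule homotopic_paths_braid[where m = n])
    show cn: "continuous_on {0..1} n"
      unfolding n_def by (intro continuous_intros continuous_on_cross)
    show "det3 (affine_vec a1) (band_vec a2 t) (n t) \<noteq> 0" for t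
      by (simp add: Z n_nonzero)
    have "path n" "pathstart n = d *\<^sub>R vertical_vec" "pathfinish n = - (d *\<^sub>R vertical_vec)"
      using cn by (simp_all add: path_def pathstart_def pathfinish_def n_ends)
    then show "path w"
      by (simp add: w_def)
    show "path k"
      unfolding k_def
      by (intro path_join_imp) (auto simp: path_def pathstart_def pathfinish_def joinpaths_def)
    show "path_image k \<subseteq> {0..1}"
      by (auto simp: k_def path_image_def joinpaths_def)
    show "(0::real) = k 0" "affine_vec a3 = w 0" "(1::real) = k 1" "affine_vec a3 = w 1"
      by (simp_all add: k_def w_def joinpaths_def linepath_def)
    fix t :: real assume t: "t \<in> {0..1}"
    show "segment_off_axes (det3 (affine_vec a3) (band_vec a2 t) (n t))
        (det3 (affine_vec a1) (affine_vec a3) (n t)) (det3 (affine_vec a1) (band_vec a2 t) (affine_vec a3))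
        (det3 (w t) (band_vec a2 (k t)) (n (k t))) (det3 (affine_vec a1) (w t) (n (k t)))
        (det3 (affine_vec a1) (band_vec a2 (k t)) (w t))"
      using t
    proof (cases rule: unit_interval_cases)
      case 1
      have "k 0 = 0" "w 0 = affine_vec a3"
        by (simp_all add: k_def w_def joinpaths_def linepath_def)
      then show ?thesis
        using 1 assms \<open>0 < d\<close>
        by (auto intro!: segment_off_axes_refl simp: n_ends det3_affine_vertical)
    next
      case 2
      then have "n t \<bullet> affine_vec a3 < 0"
        using assms trig_quadrants[of t] by (simp add: z0)
      moreover have "n (k t) \<bullet> w t < 0"
      proof (cases "t \<le> 1 / 4")
        case True
        then have "k t = 0" "w t = (1 - 4 * t) *\<^sub>R affine_vec a3 - (4 * t) *\<^sub>R (d *\<^sub>R vertical_vec)"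
          by (simp_all add: k_def w_def joinpaths_def linepath_def)
        then show ?thesis
          using 2 \<open>0 < d\<close> by (simp add: n_ends)
      next
        case False
        define p where "p = 2 * (2 * t) - 1"
        have "k t = 0" "w t = - ((1 - p) *\<^sub>R (d *\<^sub>R vertical_vec)) - p *\<^sub>R affine_vec a3"
          using False 2 by (simp_all add: k_def w_def joinpaths_def linepath_def p_def)
        moreover have "p < 1"
          using 2 by (simp add: p_def)
        ultimately show ?thesis
          using \<open>0 < d\<close> by (simp add: n_ends)
      qed
      ultimately show ?thesis
        unfolding Z segment_off_axes_def by (simp add: mult_neg_neg)
    next
      case 3
      \<comment> \<open>Both third coordinates vanish at this moment, so the first two decide: they
        are positive and negative, respectively, for both vectors.\<close>
      have kw: "k t = 0" "w t = - affine_vec a3"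
        unfolding 3 by (simp_all add: k_def w_def joinpaths_def linepath_def)
      have x1: "det3 (w t) (band_vec a2 (k t)) (n (k t)) = d * (a3 - a2)"
        and y1: "det3 (affine_vec a1) (w t) (n (k t)) = - (d * (a3 - a1))"
        unfolding kw by (simp_all add: n_ends det3_affine_vertical algebra_simps)
      have x0: "det3 (affine_vec a3) (band_vec a2 t) (n t) = 1"
        and y0: "det3 (affine_vec a1) (affine_vec a3) (n t) = - (a3 - a1)"
        unfolding 3 by (simp_all add: det3_def n_eq cross3_def inner_vec_def sum_3 band_vec_def)
      show ?thesis
        unfolding x0 y0 x1 y1
        using assms \<open>0 < d\<close> mult_nonpos_nonneg[of "a1 - a3" "d * (a3 - a1)"]
        by (simp add: segment_off_axes_def off_axes_def)
    next
      case 4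
      then have "0 < n t \<bullet> affine_vec a3"
        using assms trig_quadrants[of t] by (simp add: z0 mult_pos_neg)
      moreover have "0 < n (k t) \<bullet> w t"
      proof -
        define p q where "p = 2 * t - 1" and "q = 2 * (2 * t - 1) - 1"
        consider "t \<le> 3 / 4" | "3 / 4 < t" "t \<le> 7 / 8" | "7 / 8 < t"
          by linarith
        then show ?thesis
        proof cases
          case 1
          then have "k t = 0" "w t = (2 * p) *\<^sub>R (d *\<^sub>R vertical_vec) - (1 - 2 * p) *\<^sub>R affine_vec a3"
            using 4 by (simp_all add: k_def w_def joinpaths_def linepath_def p_def)
          moreover have "0 < p"
            using 4 by (simp add: p_def)
          ultimately show ?thesis
            using \<open>0 < d\<close> by (simp add: n_ends)
        next
          case 2
          then have "w t = n (k t)"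
            by (simp add: k_def w_def joinpaths_def)
          then show ?thesis
            using nn by simp
        next
          case 3
          then have "k t = 1" "w t = (2 * q - 1) *\<^sub>R affine_vec a3 - (1 - (2 * q - 1)) *\<^sub>R (d *\<^sub>R vertical_vec)"
            by (simp_all add: k_def w_def joinpaths_def linepath_def q_def)
          moreover have "2 * q - 1 < 1"
            using 4 by (simp add: q_def)
          ultimately show ?thesis
            using \<open>0 < d\<close> by (simp add: n_ends)
        qed
      qed
      ultimately show ?thesis
        unfolding Z segment_off_axes_def by simp
    next
      case 5
      have "k 1 = 1" "w 1 = affine_vec a3"
        by (simp_all add: k_def w_def joinpaths_def linepath_def)
      moreover have "det3 (affine_vec a3) (band_vec a2 1) (n 1) = d * (a2 - a3)"
          "det3 (affine_vec a1) (affine_vec a3) (n 1) = d * (a1 - a3)"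
        by (simp_all add: n_eq det3_def cross3_def inner_vec_def sum_3 affine_vec_def algebra_simps)
      ultimately show ?thesis
        using 5 assms \<open>0 < d\<close> by (auto intro!: segment_off_axes_refl)
    qed
  qed (auto simp: path_def path_image_def intro!: continuous_on_band_vec)
  moreover have "band_vec a2 \<circ> k = ((\<lambda>_. affine_vec a2) +++ (\<lambda>_. affine_vec a2)) +++
       ((\<lambda>_. affine_vec a2) +++ (band_vec a2 +++ (\<lambda>_. - affine_vec a2)))"
    by (auto simp: k_def joinpaths_def)
  ultimately show ?thesis
    by (simp add: o_def w_def n_def d_def)
qed

subsection \<open>The cross product section\<close>

definition cross_section :: "rp2^2 \<Rightarrow> rp2^3" where
  "cross_section x = add3 x (rp2_point (cross3 (rp2_unit (x $ 1)) (rp2_unit (x $ 2))))"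

text \<open>Scalars factor out of the cross product, so any homogeneous coordinates may replace the
  chosen unit vectors.\<close>

lemma cross_section_lines:
  assumes "x $ 1 = rp2_point u" "x $ 2 = rp2_point v" "u \<noteq> 0" "v \<noteq> 0"
  shows "cross_section x = lines u v (cross3 u v)"
proof -
  obtain c where c: "c \<noteq> 0" "u = c *\<^sub>R rp2_unit (rp2_point u)"
    using rp2_unit_point[OF assms(3)] .
  obtain d where d: "d \<noteq> 0" "v = d *\<^sub>R rp2_unit (rp2_point v)"
    using rp2_unit_point[OF assms(4)] .
  have "cross3 u v = (c * d) *\<^sub>R cross3 (rp2_unit (rp2_point u)) (rp2_unit (rp2_point v))"
    by (subst c(2), subst d(2)) (simp add: cross_mult_left cross_mult_right)
  then have "rp2_point (cross3 u v) = rp2_point (cross3 (rp2_unit (rp2_point u)) (rp2_unit (rp2_point v)))"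
    using c(1) d(1) by (simp add: rp2_point_scaleR)
  then show ?thesis
    using assms by (simp add: cross_section_def add3_def vec_eq_iff forall_3)
qed

lemma vec3_eqI: "x $ 1 = y $ 1 \<Longrightarrow> x $ 2 = y $ 2 \<Longrightarrow> x $ 3 = y $ 3 \<Longrightarrow> x = y"
  for x y :: "'a^3"
  by (simp add: vec_eq_iff forall_3)

lemma forget3_cross_section [simp]: "forget3 (cross_section x) = x"
  by (simp add: cross_section_def forget3_def add3_def vec_eq_iff forall_2)

text \<open>In the frame \<open>u\<close>, \<open>v\<close>, \<open>u \<times> v\<close> the new
  point has coordinates 0, 0, 1.\<close>

lemma cross_section_in_config_space:
  assumes "x \<in> config_space"
  shows "cross_section x \<in> config_space"
proof -
  let ?u = "rp2_unit (x $ 1)" and ?v = "rp2_unit (x $ 2)"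
  have "cross3 ?u ?v \<noteq> 0"
    using assms rp2_point_eq_iff[of ?u ?v] by (auto simp: config_space_2_iff)
  then have "lines ?u ?v (1 *\<^sub>R cross3 ?u ?v) \<in> config_space"
    using lines_frame_in_config_space[of ?u ?v "cross3 ?u ?v" 0 0 1]
    by (simp add: det3_def off_axes_def)
  then show ?thesis
    using cross_section_lines[of x ?u ?v] by simp
qed

text \<open>On a convex domain the two points lift continuously to unit vectors, and these lifts may
  be used in place of the choice \<open>rp2_unit\<close>. Homotopies of paths have the square as
  domain, so this form of continuity suffices for them.\<close>

lemma continuous_on_cross_section:
  fixes h :: "'c::{real_normed_vector} \<Rightarrow> rp2^2"
  assumes "convex U" "continuous_on U h" "h ` U \<subseteq> config_space"
  shows "continuous_on U (\<lambda>q. cross_section (h q))"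
proof -
  obtain u where u: "continuous_on U u" "\<And>q. norm (u q) = 1" "\<And>q. q \<in> U \<Longrightarrow> rp2_point (u q) = h q $ 1"
    by (rule rp2_lift[OF assms(1) continuous_on_component[OF assms(2)], of 1]) (rule that)
  obtain v where v: "continuous_on U v" "\<And>q. norm (v q) = 1" "\<And>q. q \<in> U \<Longrightarrow> rp2_point (v q) = h q $ 2"
    by (rule rp2_lift[OF assms(1) continuous_on_component[OF assms(2)], of 2]) (rule that)
  have nonzero: "u q \<noteq> 0" "v q \<noteq> 0" for q
    using u(2)[of q] v(2)[of q] by auto
  have "cross3 (u q) (v q) \<noteq> 0" if "q \<in> U" for q
  proof -
    have "h q \<in> config_space"
      using assms(3) that by blast
    then have "rp2_point (u q) \<noteq> rp2_point (v q)"
      using u(3)[OF that] v(3)[OF that] by (simp add: config_space_2_iff)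
    then show ?thesis
      using nonzero by (simp add: rp2_point_eq_iff)
  qed
  then have "continuous_on U (\<lambda>q. lines (u q) (v q) (cross3 (u q) (v q)))"
    using u(1) v(1) nonzero by (intro continuous_on_lines continuous_on_cross) auto
  moreover have "lines (u q) (v q) (cross3 (u q) (v q)) = cross_section (h q)" if "q \<in> U" for q
    using cross_section_lines[of "h q" "u q" "v q"] u(3)[OF that] v(3)[OF that] nonzero by simp
  ultimately show ?thesis
    by (rule continuous_on_eq)
qed

lemma homotopic_paths_cross_section:
  assumes "homotopic_paths config_space p q"
  shows "homotopic_paths config_space (cross_section \<circ> p) (cross_section \<circ> q)"
proof -
  let ?Q = "{0..1} \<times> {0..1} :: (real \<times> real) set"
  obtain h where h: "continuous_on ?Q h" "h \<in> ?Q \<rightarrow> config_space"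
    "\<forall>t\<in>{0..1}. h (0, t) = p t" "\<forall>t\<in>{0..1}. h (1, t) = q t"
    "\<forall>r\<in>{0..1}. pathstart (h \<circ> Pair r) = pathstart p \<and> pathfinish (h \<circ> Pair r) = pathfinish p"
    using assms unfolding homotopic_paths by blast
  have "continuous_on ?Q (\<lambda>q. cross_section (h q))"
    using h by (intro continuous_on_cross_section convex_Times) auto
  moreover have "(\<lambda>q. cross_section (h q)) \<in> ?Q \<rightarrow> config_space"
    using h(2) cross_section_in_config_space by blast
  ultimately show ?thesis
    unfolding homotopic_paths using h(3-5)
    by (intro exI[of _ "\<lambda>q. cross_section (h q)"]) (auto simp: pathstart_def pathfinish_def)
qed

text \<open>A change of base point along \<open>g\<close> composed with a map that need only respect homotopies.\<close>

definition conjugate_map ::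
    "'b::topological_space set \<Rightarrow> (real \<Rightarrow> 'b) \<Rightarrow> ('a::topological_space \<Rightarrow> 'b)
      \<Rightarrow> (real \<Rightarrow> 'a) set \<Rightarrow> (real \<Rightarrow> 'b) set" where
  "conjugate_map Y g f A = (\<Union>p\<in>A. path_class Y (g +++ ((f \<circ> p) +++ reversepath g)))"

context
  fixes X :: "'a::topological_space set" and Y :: "'b::topological_space set" and f g x
  assumes f: "\<And>p q. homotopic_paths X p q \<Longrightarrow> homotopic_paths Y (f \<circ> p) (f \<circ> q)"
    and g: "path g" "path_image g \<subseteq> Y" "pathfinish g = f x"
begin

lemma compose_loop:
  assumes "p \<in> loops X x"
  shows "path (f \<circ> p)" "path_image (f \<circ> p) \<subseteq> Y" "pathstart (f \<circ> p) = f x" "pathfinish (f \<circ> p) = f x"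
  \<comment> \<open>That \<open>p\<close> is homotopic to itself in \<open>X\<close> means exactly
    that it is a path in \<open>X\<close>; the assumption on \<open>f\<close> therefore yields a
    path in \<open>Y\<close>.\<close>
  using f[of p p] assms by (auto simp: loops_def pathstart_compose pathfinish_compose)

lemma conjugate_loop:
  assumes "p \<in> loops X x"
  shows "g +++ ((f \<circ> p) +++ reversepath g) \<in> loops Y (pathstart g)"
  using compose_loop[OF assms] g by (simp add: loops_def path_image_join)

lemma conjugate_map_path_class:
  assumes p: "p \<in> loops X x"
  shows "conjugate_map Y g f (path_class X p) = path_class Y (g +++ ((f \<circ> p) +++ reversepath g))"
proof -
  have eq: "path_class Y (g +++ ((f \<circ> q) +++ reversepath g)) =
      path_class Y (g +++ ((f \<circ> p) +++ reversepath g))" if "q \<in> path_class X p" for q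
  proof -
    have "homotopic_paths Y (f \<circ> p) (f \<circ> q)"
      using that by (intro f) (simp add: path_class_def)
    then have "homotopic_paths Y (g +++ ((f \<circ> p) +++ reversepath g)) (g +++ ((f \<circ> q) +++ reversepath g))"
      using compose_loop[OF p] g by (intro homotopic_paths_join) auto
    then show ?thesis
      by (rule path_class_eqI[symmetric])
  qed
  have "(\<Union>q\<in>path_class X p. path_class Y (g +++ ((f \<circ> q) +++ reversepath g))) =
      (\<Union>q\<in>path_class X p. path_class Y (g +++ ((f \<circ> p) +++ reversepath g)))"
    by (intro SUP_cong refl eq)
  moreover have "p \<in> path_class X p"
    using p by (auto simp: path_class_def loops_def)
  ultimately show ?thesis
    by (auto simp: conjugate_map_def)
qed

lemma conjugate_map_hom:
  "conjugate_map Y g f \<in> hom (fundamental_group X x) (fundamental_group Y (pathstart g))"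
proof (rule homI)
  fix A assume "A \<in> carrier (fundamental_group X x)"
  then obtain p where "p \<in> loops X x" "A = path_class X p"
    by (rule fundamental_group_carrierE)
  then show "conjugate_map Y g f A \<in> carrier (fundamental_group Y (pathstart g))"
    by (auto simp: conjugate_map_path_class fundamental_group_carrier conjugate_loop)
next
  fix A B
  assume "A \<in> carrier (fundamental_group X x)" "B \<in> carrier (fundamental_group X x)"
  then obtain p q where pq: "p \<in> loops X x" "A = path_class X p" "q \<in> loops X x" "B = path_class X q"
    by (auto simp: fundamental_group_carrier)
  note P = compose_loop[OF pq(1)] and Q = compose_loop[OF pq(3)]
  let ?p = "f \<circ> p" and ?q = "f \<circ> q" and ?r = "reversepath g"
  have "homotopic_paths Y ((g +++ (?p +++ ?r)) +++ (g +++ (?q +++ ?r))) (g +++ (?p +++ (?q +++ ?r)))"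
    using P Q g by (intro homotopic_paths_cancel_middle) (auto simp: path_image_join)
  also have "homotopic_paths Y \<dots> (g +++ ((?p +++ ?q) +++ ?r))"
    using P Q g by (intro homotopic_paths_join homotopic_paths_assoc) (auto simp: path_image_join)
  finally have eq: "homotopic_paths Y ((g +++ (?p +++ ?r)) +++ (g +++ (?q +++ ?r)))
      (g +++ ((?p +++ ?q) +++ ?r))" .
  show "conjugate_map Y g f (A \<otimes>\<^bsub>fundamental_group X x\<^esub> B) =
      conjugate_map Y g f A \<otimes>\<^bsub>fundamental_group Y (pathstart g)\<^esub> conjugate_map Y g f B"
    using pq path_class_eqI[OF eq]
    by (simp add: fundamental_group_mult conjugate_map_path_class join_in_loops conjugate_loop
        path_compose_join)
qed

end


subsection \<open>The fibration sequence\<close>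

text \<open>The matrix with columns \<open>u\<close>, \<open>v\<close>, \<open>u \<times> v\<close> identifies the fibre over the point given by
  \<open>u\<close>, \<open>v\<close> with the complement of two fixed points. Up to a positive scalar, this is the change of
  fibre from \<open>(u, v)\<close> to \<open>(u', v')\<close>.\<close>

definition transfer :: "real^3 \<Rightarrow> real^3 \<Rightarrow> real^3 \<Rightarrow> real^3 \<Rightarrow> real^3 \<Rightarrow> real^3" where
  "transfer u v u' v' w = det3 w v (cross3 u v) *\<^sub>R u' + det3 u w (cross3 u v) *\<^sub>R v' +
     det3 u v w *\<^sub>R cross3 u' v'"

lemma transfer_same: "transfer u v u v w = (cross3 u v \<bullet> cross3 u v) *\<^sub>R w"
  unfolding transfer_def using cramer3[of w v "cross3 u v" u] by (simp add: det3_def)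

lemma rp2_point_transfer_same:
  "cross3 u v \<noteq> 0 \<Longrightarrow> rp2_point (transfer u v u v w) = rp2_point w"
  by (simp add: transfer_same rp2_point_scaleR)

text \<open>The transfer keeps the coordinates and changes only the frame, and avoiding the first
  two points is a condition on the coordinates alone.\<close>

lemma cross3_transfer_nonzero:
  assumes "cross3 u v \<noteq> 0" "cross3 u' v' \<noteq> 0" "cross3 u w \<noteq> 0" "cross3 v w \<noteq> 0"
  shows "cross3 u' (transfer u v u' v' w) \<noteq> 0" "cross3 v' (transfer u v u' v' w) \<noteq> 0"
proof -
  let ?n = "cross3 u v"
  \<comment> \<open>The determinant of the frame \<open>u\<close>, \<open>v\<close>,
    \<open>u \<times> v\<close> is the squared norm of \<open>u \<times> v\<close>.\<close>
  have w: "(?n \<bullet> ?n) *\<^sub>R w = det3 w v ?n *\<^sub>R u + det3 u w ?n *\<^sub>R v + det3 u v w *\<^sub>R ?n"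
    using cramer3[of w v ?n u] by (simp add: det3_def)
  have "(?n \<bullet> ?n) *\<^sub>R cross3 u w \<noteq> 0" "(?n \<bullet> ?n) *\<^sub>R cross3 v w \<noteq> 0"
    using assms by simp_all
  then have "cross3 u ((?n \<bullet> ?n) *\<^sub>R w) \<noteq> 0" "cross3 v ((?n \<bullet> ?n) *\<^sub>R w) \<noteq> 0"
    by (simp_all add: cross_mult_right)
  then have off: "off_axes (det3 w v ?n) (det3 u w ?n) (det3 u v w)"
    unfolding w off_axes_def by (auto simp: cross_add_right cross_mult_right)
  have "det3 u' v' (cross3 u' v') \<noteq> 0"
    using assms by (simp add: det3_def)
  from cross3_frame_nonzero[OF this off]
  show "cross3 u' (transfer u v u' v' w) \<noteq> 0" "cross3 v' (transfer u v u' v' w) \<noteq> 0"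
    by (simp_all add: transfer_def)
qed

lemma continuous_on_transfer:
  fixes u v u' v' w :: "'a::t2_space \<Rightarrow> real^3"
  assumes "continuous_on S u" "continuous_on S v" "continuous_on S u'" "continuous_on S v'" "continuous_on S w"
  shows "continuous_on S (\<lambda>x. transfer (u x) (v x) (u' x) (v' x) (w x))"
  unfolding transfer_def by (intro continuous_intros continuous_on_cross assms)

section \<open>The forgetful map and the inclusion of the fibre\<close>

lemma add3_components [simp]:
  "add3 x y $ 1 = x $ 1" "add3 x y $ 2 = x $ 2" "add3 x y $ 3 = y"
  by (simp_all add: add3_def)

lemma forget3_components [simp]: "forget3 x $ 1 = x $ 1" "forget3 x $ 2 = x $ 2"
  by (simp_all add: forget3_def)

lemma add3_forget3 [simp]: "add3 (forget3 x) (x $ 3) = x"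
  by (simp add: vec_eq_iff forall_3)

lemma continuous_on_forget3:
  fixes S :: "('a::topological_space^3) set"
  shows "continuous_on S forget3"
proof -
  have eq: "forget3 = (\<lambda>x :: 'a^3. \<chi> i. if i = 1 then x $ 1 else x $ 2)"
    by (simp add: fun_eq_iff forget3_def)
  show ?thesis
    unfolding eq
  proof (rule continuous_on_vec_lambda)
    show "continuous_on S (\<lambda>x. if i = 1 then x $ 1 else x $ 2)" for i :: 2
      by (cases "i = 1") (auto intro!: continuous_intros)
  qed
qed

lemma continuous_on_add3:
  fixes x :: "'a::topological_space^2"
  shows "continuous_on S (add3 x)"
proof -
  have eq: "add3 x = (\<lambda>y. \<chi> i. if i = 1 then x $ 1 else if i = 2 then x $ 2 else y)"
    by (simp add: fun_eq_iff add3_def)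
  show ?thesis
    unfolding eq
  proof (rule continuous_on_vec_lambda)
    show "continuous_on S (\<lambda>y. if i = 1 then x $ 1 else if i = 2 then x $ 2 else y)" for i :: 3
      by (cases "i = 1"; cases "i = 2"; simp)
  qed
qed

lemma forget3_in_config_space: "x \<in> config_space \<Longrightarrow> forget3 x \<in> config_space"
  by (simp add: config_space_2_iff config_space_3_iff)

lemma add3_in_config_space:
  assumes "x \<in> config_space" "y \<in> UNIV - {x $ 1, x $ 2}"
  shows "add3 (forget3 x) y \<in> config_space"
  using assms by (auto simp: config_space_3_iff)

section \<open>Lifts on the square, and exactness at the level of loops\<close>

lemma square_lift:
  fixes h :: "real \<times> real \<Rightarrow> rp2"
  assumes "continuous_on ({0..1} \<times> {0..1}) h"
  obtains u where "continuous_on ({0..1} \<times> {0..1}) u" "\<And>q. norm (u q) = 1"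
    "\<And>q. q \<in> {0..1} \<times> {0..1} \<Longrightarrow> rp2_point (u q) = h q"
  using rp2_lift[OF convex_Times[OF convex_real_interval(5) convex_real_interval(5)] assms] by blast

text \<open>Each of the three edges is connected and neighbouring edges share a corner. The
  conclusion concerns the vectors themselves and not only their lines; the transfer needs this, as
  changing the sign of one frame vector alters it.\<close>

lemma square_lift_constant:
  fixes u :: "real \<times> real \<Rightarrow> real^3"
  assumes u: "continuous_on ({0..1} \<times> {0..1}) u" "\<And>q. norm (u q) = 1"
    and edges: "\<And>t. t \<in> {0..1} \<Longrightarrow> rp2_point (u (1, t)) = L"
      "\<And>r. r \<in> {0..1} \<Longrightarrow> rp2_point (u (r, 0)) = L" "\<And>r. r \<in> {0..1} \<Longrightarrow> rp2_point (u (r, 1)) = L"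
    and "t \<in> {0..1}"
  shows "u (1, t) = u (0, 0)" "u (t, 0) = u (0, 0)" "u (t, 1) = u (0, 0)"
proof -
  have const: "u x = u y"
    if "connected T" "T \<subseteq> {0..1} \<times> {0..1}" "\<And>q. q \<in> T \<Longrightarrow> rp2_point (u q) = L" "x \<in> T" "y \<in> T" for T x y
    using rp2_lift_constant[OF that(1) continuous_on_subset[OF u(1) that(2)] u(2)] that by blast
  have bottom: "u (s, 0) = u (0, 0)" if "s \<in> {0..1}" for s
    by (rule const[of "{0..1} \<times> {0}"]) (use that edges in \<open>auto intro!: connected_Times\<close>)
  have right: "u (1, s) = u (1, 0)" if "s \<in> {0..1}" for s
    by (rule const[of "{1} \<times> {0..1}"]) (use that edges in \<open>auto intro!: connected_Times\<close>)
  have top: "u (s, 1) = u (1, 1)" if "s \<in> {0..1}" for s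
    by (rule const[of "{0..1} \<times> {1}"]) (use that edges in \<open>auto intro!: connected_Times\<close>)
  show "u (1, t) = u (0, 0)" "u (t, 0) = u (0, 0)" "u (t, 1) = u (0, 0)"
    using assms(6) bottom[of t] bottom[of 1] right[of t] right[of 1] top[of t] by auto
qed

text \<open>The contraction of the projected loop is lifted to frames over the square. Moving the
  third point of \<open>\<beta> t\<close> along with the frame deforms \<open>\<beta>\<close> into a
  loop whose first two points rest.\<close>

lemma fibre_loop_of_kernel:
  fixes x :: "rp2^3"
  assumes \<beta>: "\<beta> \<in> loops config_space x"
    and null: "homotopic_paths config_space (forget3 \<circ> \<beta>) (\<lambda>_. forget3 x)"
  obtains \<alpha> where "\<alpha> \<in> loops (UNIV - {x $ 1, x $ 2}) (x $ 3)"
    "homotopic_paths config_space \<beta> (add3 (forget3 x) \<circ> \<alpha>)"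
proof -
  let ?Q = "{0..1} \<times> {0..1} :: (real \<times> real) set"
  note B = loopsD[OF \<beta>]
  have \<beta>01: "\<beta> 0 = x" "\<beta> 1 = x" "\<And>t. t \<in> {0..1} \<Longrightarrow> \<beta> t \<in> config_space"
    using B by (auto simp: pathstart_def pathfinish_def path_image_def)
  obtain h where h: "continuous_on ?Q h" "h \<in> ?Q \<rightarrow> config_space"
    "\<forall>t\<in>{0..1}. h (0, t) = (forget3 \<circ> \<beta>) t" "\<forall>t\<in>{0..1}. h (1, t) = forget3 x"
    "\<forall>r\<in>{0..1}. pathstart (h \<circ> Pair r) = pathstart (forget3 \<circ> \<beta>) \<and>
      pathfinish (h \<circ> Pair r) = pathfinish (forget3 \<circ> \<beta>)"
    using null unfolding homotopic_paths by blast
  have edge: "h (r, 0) = forget3 x" "h (r, 1) = forget3 x" if "r \<in> {0..1}" for r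
    using h(5) that \<beta>01 by (auto simp: pathstart_def pathfinish_def)
  obtain u where u: "continuous_on ?Q u" "\<And>q. norm (u q) = 1" "\<And>q. q \<in> ?Q \<Longrightarrow> rp2_point (u q) = h q $ 1"
    by (rule square_lift[OF continuous_on_component[OF h(1)], of 1]) (rule that)
  obtain v where v: "continuous_on ?Q v" "\<And>q. norm (v q) = 1" "\<And>q. q \<in> ?Q \<Longrightarrow> rp2_point (v q) = h q $ 2"
    by (rule square_lift[OF continuous_on_component[OF h(1)], of 2]) (rule that)
  have "continuous_on {0..1} (\<lambda>t. \<beta> t $ 3)"
    using B(1) by (intro continuous_on_component) (simp add: path_def)
  then obtain w where w: "continuous_on {0..1} w" "\<And>t. norm (w t) = 1"
      "\<And>t. t \<in> {0..1} \<Longrightarrow> rp2_point (w t) = \<beta> t $ 3"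
    using rp2_lift[OF convex_real_interval(5)] by blast
  have nonzero: "u q \<noteq> 0" "v q \<noteq> 0" "w t \<noteq> 0" for q t
    using u(2)[of q] v(2)[of q] w(2)[of t] by auto
  have uv: "cross3 (u q) (v q) \<noteq> 0" if "q \<in> ?Q" for q
  proof -
    have "h q \<in> config_space"
      using h(2) that by blast
    then have "rp2_point (u q) \<noteq> rp2_point (v q)"
      using u(3)[OF that] v(3)[OF that] by (simp add: config_space_2_iff)
    then show ?thesis
      using nonzero by (simp add: rp2_point_eq_iff)
  qed
  have uw: "cross3 (u (0, t)) (w t) \<noteq> 0" "cross3 (v (0, t)) (w t) \<noteq> 0" if t: "t \<in> {0..1}" for t
  proof -
    have "rp2_point (u (0, t)) \<noteq> rp2_point (w t)" "rp2_point (v (0, t)) \<noteq> rp2_point (w t)"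
      using u(3)[of "(0, t)"] v(3)[of "(0, t)"] w(3)[OF t] h(3) \<beta>01(3)[OF t] t
      by (auto simp: config_space_3_iff)
    then show "cross3 (u (0, t)) (w t) \<noteq> 0" "cross3 (v (0, t)) (w t) \<noteq> 0"
      using nonzero by (simp_all add: rp2_point_eq_iff)
  qed
  have u_edge: "u (1, t) = u (0, 0)" "u (t, 0) = u (0, 0)" "u (t, 1) = u (0, 0)" if "t \<in> {0..1}" for t
    by (rule square_lift_constant[OF u(1,2), of "x $ 1"]; use u(3) h(4) edge that in simp)+
  have v_edge: "v (1, t) = v (0, 0)" "v (t, 0) = v (0, 0)" "v (t, 1) = v (0, 0)" if "t \<in> {0..1}" for t
    by (rule square_lift_constant[OF v(1,2), of "x $ 2"]; use v(3) h(4) edge that in simp)+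
  \<comment> \<open>The third vector is transferred from the frame at \<open>(0, t)\<close>, where
    \<open>\<beta>\<close> lives, to the frame at \<open>(r, t)\<close>.\<close>
  define W where "W = (\<lambda>q. transfer (u (0, snd q)) (v (0, snd q)) (u q) (v q) (w (snd q)))"
  define K where "K = (\<lambda>q. lines (u q) (v q) (W q))"
  define \<alpha> where "\<alpha> = (\<lambda>t. rp2_point (W (1, t)))"
  have W: "cross3 (u q) (W q) \<noteq> 0" "cross3 (v q) (W q) \<noteq> 0" if "q \<in> ?Q" for q
    unfolding W_def using that uv uw by (intro cross3_transfer_nonzero; auto)+
  have contW: "continuous_on ?Q W"
    unfolding W_def
    by (intro continuous_on_transfer u(1) v(1) continuous_on_compose2[OF u(1)]
        continuous_on_compose2[OF v(1)] continuous_on_compose2[OF w(1)] continuous_intros) auto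
  have W_nonzero: "W q \<noteq> 0" if "q \<in> ?Q" for q
    using W(1)[OF that] by auto
  \<comment> \<open>On these edges the initial and the final frame are both the frame at
    \<open>(0, 0)\<close>, and such a transfer is multiplication by a scalar.\<close>
  have ends: "rp2_point (W (r, 0)) = x $ 3" "rp2_point (W (r, 1)) = x $ 3" if "r \<in> {0..1}" for r
    using u_edge[OF that] v_edge[OF that] u_edge[of 0] v_edge[of 0] uv[of "(0, 0)"] w(3)[of 0] w(3)[of 1] \<beta>01
    by (simp_all add: W_def rp2_point_transfer_same)
  have x12: "rp2_point (u (0, 0)) = x $ 1" "rp2_point (v (0, 0)) = x $ 2"
    using u(3)[of "(0, 0)"] v(3)[of "(0, 0)"] edge[of 0] by auto
  have "\<alpha> \<in> loops (UNIV - {x $ 1, x $ 2}) (x $ 3)"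
  proof -
    have "path \<alpha>"
      unfolding path_def \<alpha>_def
      by (intro continuous_on_rp2_point_compose continuous_on_compose2[OF contW] continuous_intros)
        (auto simp: W_nonzero)
    have "\<alpha> t \<in> UNIV - {x $ 1, x $ 2}" if t: "t \<in> {0..1}" for t
    proof -
      have "x $ 1 \<noteq> \<alpha> t" "x $ 2 \<noteq> \<alpha> t"
        using W[of "(1, t)"] W_nonzero[of "(1, t)"] u_edge[OF t] v_edge[OF t] t nonzero
        unfolding \<alpha>_def x12[symmetric] by (simp_all add: rp2_point_eq_iff)
      then show ?thesis
        by simp
    qed
    then have "path_image \<alpha> \<subseteq> UNIV - {x $ 1, x $ 2}"
      unfolding path_image_def by (rule image_subsetI)
    moreover have "pathstart \<alpha> = x $ 3" "pathfinish \<alpha> = x $ 3"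
      unfolding pathstart_def pathfinish_def \<alpha>_def by (rule ends; simp)+
    ultimately show ?thesis
      using \<open>path \<alpha>\<close> unfolding loops_def by blast
  qed
  moreover have "homotopic_paths config_space \<beta> (add3 (forget3 x) \<circ> \<alpha>)"
  proof -
    have "continuous_on ?Q K"
      unfolding K_def using u(1) v(1) contW nonzero W_nonzero by (intro continuous_on_lines) auto
    moreover have "K \<in> ?Q \<rightarrow> config_space"
      unfolding K_def using uv W by (intro Pi_I lines_in_config_space) auto
    moreover have "K (0, t) = \<beta> t" if t: "t \<in> {0..1}" for t
      using u(3)[of "(0, t)"] v(3)[of "(0, t)"] w(3)[OF t] h(3) t uv[of "(0, t)"]
      by (intro vec3_eqI) (auto simp: K_def W_def rp2_point_transfer_same)
    moreover have "K (1, t) = (add3 (forget3 x) \<circ> \<alpha>) t" if t: "t \<in> {0..1}" for t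
      using u_edge[OF t] v_edge[OF t] x12 by (intro vec3_eqI) (simp_all add: K_def \<alpha>_def)
    moreover have "K (r, 0) = x" "K (r, 1) = x" if r: "r \<in> {0..1}" for r
      using ends[OF r] u_edge[OF r] v_edge[OF r] x12 by (intro vec3_eqI; simp add: K_def)+
    ultimately show ?thesis
      unfolding homotopic_paths using \<beta>01
      by (intro exI[of _ K]) (auto simp: pathstart_def pathfinish_def)
  qed
  ultimately show ?thesis
    by (rule that)
qed

text \<open>In a contraction among configurations the first two points may move. Transferring each
  third point back to the frame at \<open>(0, 0)\<close> gives a contraction inside the
  fibre.\<close>

lemma fibre_loop_null:
  fixes x :: "rp2^3"
  assumes \<alpha>: "\<alpha> \<in> loops (UNIV - {x $ 1, x $ 2}) (x $ 3)"
    and null: "homotopic_paths config_space (add3 (forget3 x) \<circ> \<alpha>) (\<lambda>_. x)"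
  shows "homotopic_paths (UNIV - {x $ 1, x $ 2}) \<alpha> (\<lambda>_. x $ 3)"
proof -
  let ?Q = "{0..1} \<times> {0..1} :: (real \<times> real) set"
  have \<alpha>01: "\<alpha> 0 = x $ 3" "\<alpha> 1 = x $ 3"
    using loopsD[OF \<alpha>] by (auto simp: pathstart_def pathfinish_def)
  obtain h where h: "continuous_on ?Q h" "h \<in> ?Q \<rightarrow> config_space"
    "\<forall>t\<in>{0..1}. h (0, t) = (add3 (forget3 x) \<circ> \<alpha>) t" "\<forall>t\<in>{0..1}. h (1, t) = x"
    "\<forall>r\<in>{0..1}. pathstart (h \<circ> Pair r) = pathstart (add3 (forget3 x) \<circ> \<alpha>) \<and>
      pathfinish (h \<circ> Pair r) = pathfinish (add3 (forget3 x) \<circ> \<alpha>)"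
    using null unfolding homotopic_paths by blast
  have edge: "h (r, 0) = x" "h (r, 1) = x" if "r \<in> {0..1}" for r
    using h(5) that \<alpha>01 by (auto simp: pathstart_def pathfinish_def)
  obtain u where u: "continuous_on ?Q u" "\<And>q. norm (u q) = 1" "\<And>q. q \<in> ?Q \<Longrightarrow> rp2_point (u q) = h q $ 1"
    by (rule square_lift[OF continuous_on_component[OF h(1)], of 1]) (rule that)
  obtain v where v: "continuous_on ?Q v" "\<And>q. norm (v q) = 1" "\<And>q. q \<in> ?Q \<Longrightarrow> rp2_point (v q) = h q $ 2"
    by (rule square_lift[OF continuous_on_component[OF h(1)], of 2]) (rule that)
  obtain w where w: "continuous_on ?Q w" "\<And>q. norm (w q) = 1" "\<And>q. q \<in> ?Q \<Longrightarrow> rp2_point (w q) = h q $ 3"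
    by (rule square_lift[OF continuous_on_component[OF h(1)], of 3]) (rule that)
  have nonzero: "u q \<noteq> 0" "v q \<noteq> 0" "w q \<noteq> 0" for q
    using u(2)[of q] v(2)[of q] w(2)[of q] by auto
  have cross: "cross3 (u q) (v q) \<noteq> 0" "cross3 (u q) (w q) \<noteq> 0" "cross3 (v q) (w q) \<noteq> 0" if "q \<in> ?Q" for q
  proof -
    have "h q \<in> config_space"
      using h(2) that by blast
    then have "rp2_point (u q) \<noteq> rp2_point (v q)" "rp2_point (u q) \<noteq> rp2_point (w q)"
        "rp2_point (v q) \<noteq> rp2_point (w q)"
      using u(3)[OF that] v(3)[OF that] w(3)[OF that] by (simp_all add: config_space_3_iff)
    then show "cross3 (u q) (v q) \<noteq> 0" "cross3 (u q) (w q) \<noteq> 0" "cross3 (v q) (w q) \<noteq> 0"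
      using nonzero by (simp_all add: rp2_point_eq_iff)
  qed
  have u_edge: "u (1, t) = u (0, 0)" "u (t, 0) = u (0, 0)" "u (t, 1) = u (0, 0)" if "t \<in> {0..1}" for t
    by (rule square_lift_constant[OF u(1,2), of "x $ 1"]; use u(3) h(4) edge that in simp)+
  have v_edge: "v (1, t) = v (0, 0)" "v (t, 0) = v (0, 0)" "v (t, 1) = v (0, 0)" if "t \<in> {0..1}" for t
    by (rule square_lift_constant[OF v(1,2), of "x $ 2"]; use v(3) h(4) edge that in simp)+
  \<comment> \<open>The left edge carries the fibre loop, along which the first two points rest; so
    the frame is constant on the whole boundary of the square.\<close>
  have left: "u (0, t) = u (0, 0)" "v (0, t) = v (0, 0)" if t: "t \<in> {0..1}" for t
  proof -
    have sub: "{0} \<times> {0..1} \<subseteq> ?Q" and conn: "connected ({0} \<times> {0..1} :: (real \<times> real) set)"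
      by (auto intro!: connected_Times)
    show "u (0, t) = u (0, 0)"
      by (rule rp2_lift_constant[OF conn continuous_on_subset[OF u(1) sub] u(2), of "x $ 1"])
        (use u(3) h(3) t in auto)
    show "v (0, t) = v (0, 0)"
      by (rule rp2_lift_constant[OF conn continuous_on_subset[OF v(1) sub] v(2), of "x $ 2"])
        (use v(3) h(3) t in auto)
  qed
  have x12: "rp2_point (u (0, 0)) = x $ 1" "rp2_point (v (0, 0)) = x $ 2"
    using u(3)[of "(0, 0)"] v(3)[of "(0, 0)"] edge[of 0] by auto
  define W where "W = (\<lambda>q. transfer (u q) (v q) (u (0, 0)) (v (0, 0)) (w q))"
  define K where "K = (\<lambda>q. rp2_point (W q))"
  have W: "cross3 (u (0, 0)) (W q) \<noteq> 0" "cross3 (v (0, 0)) (W q) \<noteq> 0" if "q \<in> ?Q" for q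
    unfolding W_def using cross[OF that] cross[of "(0, 0)"] by (intro cross3_transfer_nonzero; simp)+
  then have W_nonzero: "W q \<noteq> 0" if "q \<in> ?Q" for q
    using that by force
  have "continuous_on ?Q W"
    unfolding W_def using u(1) v(1) w(1) by (intro continuous_on_transfer continuous_on_const)
  then have "continuous_on ?Q K"
    unfolding K_def using W_nonzero by (rule continuous_on_rp2_point_compose)
  moreover have "K \<in> ?Q \<rightarrow> UNIV - {x $ 1, x $ 2}"
  proof
    fix q assume q: "q \<in> ?Q"
    show "K q \<in> UNIV - {x $ 1, x $ 2}"
      using rp2_point_eq_iff[OF nonzero(1) W_nonzero[OF q]] rp2_point_eq_iff[OF nonzero(2) W_nonzero[OF q]] W[OF q]
      unfolding K_def x12[symmetric] by (metis DiffI UNIV_I insertE singletonD)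
  qed
  \<comment> \<open>Where the frame is the one at \<open>(0, 0)\<close>, the transfer does not move
    the third point, and the boundary values of \<open>h\<close> are kept.\<close>
  moreover have K: "K (r, t) = h (r, t) $ 3"
    if "r \<in> {0..1}" "t \<in> {0..1}" "u (r, t) = u (0, 0)" "v (r, t) = v (0, 0)" for r t
    using that w(3)[of "(r, t)"] cross[of "(0, 0)"] by (simp add: K_def W_def rp2_point_transfer_same)
  moreover have "K (0, t) = \<alpha> t" if "t \<in> {0..1}" for t
    using K[of 0 t] left[OF that] h(3) that by simp
  moreover have "K (1, t) = x $ 3" "K (t, 0) = x $ 3" "K (t, 1) = x $ 3" if "t \<in> {0..1}" for t
    using K[of 1 t] K[of t 0] K[of t 1] u_edge[OF that] v_edge[OF that] h(4) edge[OF that] that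
    by simp_all
  ultimately show ?thesis
    unfolding homotopic_paths using \<alpha>01
    by (intro exI[of _ K]) (auto simp: pathstart_def pathfinish_def)
qed

subsection \<open>The splitting\<close>

lemma braid_minus [simp]:
  "braid (\<lambda>t. - u t) v w = braid u v w"
  "braid u (\<lambda>t. - v t) w = braid u v w"
  "braid u v (\<lambda>t. - w t) = braid u v w"
  unfolding braid_def by (intro ext vec3_eqI; simp)+

lemma linepath_minus: "linepath (- a) (- b) = (\<lambda>t. - linepath a b t)"
  for a b :: "'a::real_normed_vector"
  by (auto simp: linepath_def)

definition rho_path :: "real^'n \<Rightarrow> 'n \<Rightarrow> real \<Rightarrow> rp2^'n" where
  "rho_path a i = (\<lambda>t. \<chi> j. if j = i then band_loop (a $ i) t else base_points a $ j)"

lemma rho_eq: "rho a i = path_class config_space (rho_path a i)"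
  by (simp add: rho_def rho_path_def)

lemma base_points_component: "base_points a $ i = rp2_point (affine_vec (a $ i))"
  by (simp add: base_points_def affine_vec_def)

lemma band_loop_eq: "band_loop a t = rp2_point (band_vec a t)"
  by (simp add: band_loop_def band_vec_def)

lemma rho_path_braid:
  fixes a :: "real^3"
  shows "rho_path a 1 = braid (band_vec (a $ 1)) (\<lambda>_. affine_vec (a $ 2)) (\<lambda>_. affine_vec (a $ 3))"
    and "rho_path a 2 = braid (\<lambda>_. affine_vec (a $ 1)) (band_vec (a $ 2)) (\<lambda>_. affine_vec (a $ 3))"
    and "rho_path a 3 = braid (\<lambda>_. affine_vec (a $ 1)) (\<lambda>_. affine_vec (a $ 2)) (band_vec (a $ 3))"
  by (simp_all add: fun_eq_iff vec_eq_iff forall_3 rho_path_def braid_def base_points_component band_loop_eq)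

lemma cross_section_rho_path:
  fixes a :: "real^3"
  shows "cross_section \<circ> rho_path (forget3 a) 1 =
      braid (band_vec (a $ 1)) (\<lambda>_. affine_vec (a $ 2)) (\<lambda>t. cross3 (band_vec (a $ 1) t) (affine_vec (a $ 2)))"
    and "cross_section \<circ> rho_path (forget3 a) 2 =
      braid (\<lambda>_. affine_vec (a $ 1)) (band_vec (a $ 2)) (\<lambda>t. cross3 (affine_vec (a $ 1)) (band_vec (a $ 2) t))"
  by (auto simp: fun_eq_iff braid_def rho_path_def base_points_component band_loop_eq
      intro!: cross_section_lines)

section \<open>The legs, the generators and the splitting for fixed base points\<close>

context
  fixes a :: "real^3"
  assumes a12: "a $ 1 < a $ 2" and a23: "a $ 2 < a $ 3"
begin

abbreviation (input) "x \<equiv> base_points a"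
abbreviation (input) "x' \<equiv> base_points (forget3 a)"

text \<open>For \<open>e = 1\<close> the third point goes up in the chart, for \<open>e = -1\<close>
  it goes down. The final vectors are opposite, so both legs end at the same configuration, the
  value of the section at the base points.\<close>

definition leg :: "real \<Rightarrow> real \<Rightarrow> rp2^3" where
  "leg e = braid (\<lambda>_. affine_vec (a $ 1)) (\<lambda>_. affine_vec (a $ 2))
     (linepath (affine_vec (a $ 3)) (e *\<^sub>R ((a $ 2 - a $ 1) *\<^sub>R vertical_vec)))"

lemma base_points_forget3: "x' = forget3 x"
  by (simp add: vec_eq_iff forall_2 base_points_component)

lemma base_points_in_config_space: "x \<in> config_space"
  using a12 a23
  by (simp add: config_space_3_iff base_points_component rp2_point_eq_iff)
    (simp add: cross3_def vec_eq_iff forall_3)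

lemma base_points_in_config_space': "x' \<in> config_space"
  using base_points_in_config_space by (simp add: base_points_forget3 forget3_in_config_space)

text \<open>The three vector homotopies translated into paths of configurations. All that remains is
  to choose signs for the coordinates of each piece so that consecutive pieces fit together as
  vectors.\<close>

lemma homotopic_rho_paths:
  shows "homotopic_paths config_space (rho_path a 1)
      (leg (-1) +++ ((cross_section \<circ> rho_path (forget3 a) 1) +++ reversepath (leg 1)))" (is ?h1)
    and "homotopic_paths config_space (rho_path a 2)
      ((leg (-1) +++ reversepath (leg 1)) +++
       (leg (-1) +++ ((cross_section \<circ> rho_path (forget3 a) 2) +++ reversepath (leg (-1)))))" (is ?h2)
    and "homotopic_paths config_space (rho_path a 3) (leg 1 +++ reversepath (leg (-1)))" (is ?h3)
proof -
  let ?A = "\<lambda>i. affine_vec (a $ i)" and ?d = "(a $ 2 - a $ 1) *\<^sub>R vertical_vec"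
  \<comment> \<open>Two descriptions of the downward leg with opposite third vectors: the second is
    the one that continues from \<open>- affine_vec (a $ 3)\<close>.\<close>
  have down: "leg (-1) = braid (\<lambda>_. ?A 1) (\<lambda>_. ?A 2) (linepath (?A 3) (- ?d))"
    and down': "leg (-1) = braid (\<lambda>_. ?A 1) (\<lambda>_. ?A 2) (linepath (- ?A 3) ?d)"
    unfolding leg_def scaleR_minus1_left linepath_minus[of "?A 3" "- ?d", unfolded minus_minus] braid_minus
    by (rule refl)+
  have const: "(\<lambda>_::real. c) +++ (\<lambda>_. c) = (\<lambda>_. c)" for c :: "real^3"
    by (auto simp: joinpaths_def)
  have rev_const: "reversepath (\<lambda>_. c) = (\<lambda>_. c)" for c :: "real^3"
    by (simp add: reversepath_def)
  have up_rev: "reversepath (leg 1) = braid (\<lambda>_. ?A 1) (\<lambda>_. ?A 2) (linepath ?d (?A 3))"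
    by (simp add: leg_def reversepath_braid rev_const)
  then have up_rev1: "reversepath (leg 1) = braid (\<lambda>_. - ?A 1) (\<lambda>_. ?A 2) (linepath ?d (?A 3))"
    and up_rev2: "reversepath (leg 1) = braid (\<lambda>_. ?A 1) (\<lambda>_. ?A 2) (linepath (- ?d) (- ?A 3))"
    unfolding linepath_minus braid_minus by simp_all
  have down_rev: "reversepath (leg (-1)) = braid (\<lambda>_. ?A 1) (\<lambda>_. ?A 2) (linepath (- ?d) (?A 3))"
    by (simp add: down reversepath_braid rev_const)
  then have down_rev2: "reversepath (leg (-1)) = braid (\<lambda>_. ?A 1) (\<lambda>_. - ?A 2) (linepath (- ?d) (?A 3))"
    and down_rev3: "reversepath (leg (-1)) = braid (\<lambda>_. ?A 1) (\<lambda>_. ?A 2) (linepath ?d (- ?A 3))"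
    unfolding linepath_minus[of "- ?d" "?A 3", unfolded minus_minus] braid_minus by simp_all
  have sec1: "cross_section \<circ> rho_path (forget3 a) 1 =
      braid (band_vec (a $ 1)) (\<lambda>_. ?A 2) (\<lambda>t. - cross3 (band_vec (a $ 1) t) (?A 2))"
    by (simp add: cross_section_rho_path)
  have "leg (-1) +++ ((cross_section \<circ> rho_path (forget3 a) 1) +++ reversepath (leg 1)) =
      braid ((\<lambda>_. ?A 1) +++ (band_vec (a $ 1) +++ (\<lambda>_. - ?A 1))) (\<lambda>_. ?A 2)
        (linepath (?A 3) (- ?d) +++ ((\<lambda>t. - cross3 (band_vec (a $ 1) t) (?A 2)) +++ linepath ?d (?A 3)))"
    unfolding down sec1 up_rev1 braid_join const ..
  then show ?h1
    using homotopic_rho1[OF a12 a23] by (simp add: rho_path_braid)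
  have "(leg (-1) +++ reversepath (leg 1)) +++
       (leg (-1) +++ ((cross_section \<circ> rho_path (forget3 a) 2) +++ reversepath (leg (-1)))) =
    (braid (\<lambda>_. ?A 1) (\<lambda>_. ?A 2) (linepath (?A 3) (- ?d)) +++
     braid (\<lambda>_. ?A 1) (\<lambda>_. ?A 2) (linepath (- ?d) (- ?A 3))) +++
    (braid (\<lambda>_. ?A 1) (\<lambda>_. ?A 2) (linepath (- ?A 3) ?d) +++
     (braid (\<lambda>_. ?A 1) (band_vec (a $ 2)) (\<lambda>t. cross3 (?A 1) (band_vec (a $ 2) t)) +++
      braid (\<lambda>_. ?A 1) (\<lambda>_. - ?A 2) (linepath (- ?d) (?A 3))))"
    unfolding down[symmetric] down'[symmetric] up_rev2[symmetric] down_rev2[symmetric]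
      cross_section_rho_path(2)[symmetric] ..
  also have "\<dots> = braid (\<lambda>_. ?A 1)
      (((\<lambda>_. ?A 2) +++ (\<lambda>_. ?A 2)) +++ ((\<lambda>_. ?A 2) +++ (band_vec (a $ 2) +++ (\<lambda>_. - ?A 2))))
      ((linepath (?A 3) (- ?d) +++ linepath (- ?d) (- ?A 3)) +++
       (linepath (- ?A 3) ?d +++ ((\<lambda>t. cross3 (?A 1) (band_vec (a $ 2) t)) +++ linepath (- ?d) (?A 3))))"
    unfolding braid_join const ..
  finally show ?h2
    using homotopic_rho2[OF a12 a23] by (simp add: rho_path_braid)
  have "leg 1 +++ reversepath (leg (-1)) = braid (\<lambda>_. ?A 1) (\<lambda>_. ?A 2)
      (linepath (?A 3) ?d +++ linepath ?d (- ?A 3))"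
    unfolding down_rev3 by (simp add: leg_def braid_join const)
  then show ?h3
    using homotopic_rho3[OF a12 a23] by (simp add: rho_path_braid)
qed

lemma leg_start: "pathstart (leg e) = x"
  by (simp add: leg_def pathstart_def braid_def linepath_def vec_eq_iff forall_3 base_points_component)

lemma leg_finish: "e \<in> {1, -1} \<Longrightarrow> pathfinish (leg e) = cross_section x'"
proof -
  assume e: "e \<in> {1, -1}"
  have "cross_section x' = lines (affine_vec (a $ 1)) (affine_vec (a $ 2))
      (cross3 (affine_vec (a $ 1)) (affine_vec (a $ 2)))"
    by (rule cross_section_lines) (simp_all add: base_points_component)
  also have "cross3 (affine_vec (a $ 1)) (affine_vec (a $ 2)) = (a $ 2 - a $ 1) *\<^sub>R vertical_vec"
    by (simp add: cross3_def vec_eq_iff forall_3)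
  finally show ?thesis
    using e by (intro vec3_eqI) (auto simp: leg_def pathfinish_def braid_def linepath_def
        rp2_point_minus[of "(a $ 2 - a $ 1) *\<^sub>R vertical_vec", unfolded scaleR_minus_left[symmetric] minus_diff_eq])
qed

lemma rho_path_ends:
  fixes b :: "real^'n"
  shows "pathstart (rho_path b i) = base_points b" "pathfinish (rho_path b i) = base_points b"
  by (auto simp: rho_path_def pathstart_def pathfinish_def vec_eq_iff base_points_component band_loop_eq)

text \<open>Continuity and distinctness of the points come with the homotopies, whose first members
  these paths are.\<close>

lemma rho_path_in_loops: "i \<in> {1, 2, 3} \<Longrightarrow> rho_path a i \<in> loops config_space x"
  using homotopic_rho_paths rho_path_ends[of a]
  by (auto simp: loops_def dest: homotopic_paths_imp_path homotopic_paths_imp_subset)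

lemma rho_path_forget3: "i \<in> {1, 2} \<Longrightarrow> rho_path (forget3 a) i = forget3 \<circ> rho_path a (if i = 1 then 1 else 2)"
  by (auto simp: fun_eq_iff vec_eq_iff forall_2 rho_path_def base_points_component)

lemma rho_path_forget3_in_loops: "i \<in> {1, 2} \<Longrightarrow> rho_path (forget3 a) i \<in> loops config_space x'"
  using compose_in_loops[OF continuous_on_forget3, of config_space config_space _ x] rho_path_in_loops
  by (auto simp: rho_path_forget3 base_points_forget3 image_subset_iff forget3_in_config_space)

lemma leg_path: "e \<in> {1, -1} \<Longrightarrow> path (leg e) \<and> path_image (leg e) \<subseteq> config_space"
  using homotopic_paths_imp_path[OF homotopic_rho_paths(3)] homotopic_paths_imp_subset[OF homotopic_rho_paths(3)]
    leg_finish by (auto simp: path_image_join)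

section \<open>The induced maps on representatives, and the splitting homomorphism\<close>

lemma p_star_path_class:
  assumes "p \<in> loops config_space x"
  shows "p_star (path_class config_space p) = path_class config_space (forget3 \<circ> p)"
  unfolding p_star_def using assms forget3_in_config_space
  by (intro induced_map_path_class[OF continuous_on_forget3]) auto

lemma fibre_inclusion_star_path_class:
  assumes "p \<in> loops (UNIV - {x $ 1, x $ 2}) (x $ 3)"
  shows "fibre_inclusion_star x (path_class (UNIV - {x $ 1, x $ 2}) p) =
    path_class config_space (add3 (forget3 x) \<circ> p)"
  unfolding fibre_inclusion_star_def
  using assms add3_in_config_space[OF base_points_in_config_space]
  by (intro induced_map_path_class[OF continuous_on_add3]) auto

definition splitting where
  "splitting = conjugate_map config_space (leg (-1)) cross_section"

lemma leg_down:
  "path (leg (-1))" "path_image (leg (-1)) \<subseteq> config_space" "pathfinish (leg (-1)) = cross_section x'"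
  using leg_path leg_finish by auto

lemma splitting_hom: "splitting \<in> hom (pure_braid_group x') (pure_braid_group x)"
  unfolding splitting_def pure_braid_group_def leg_start[of "-1", symmetric]
  by (intro conjugate_map_hom homotopic_paths_cross_section leg_down)

lemma splitting_path_class:
  assumes "p \<in> loops config_space x'"
  shows "splitting (path_class config_space p) =
    path_class config_space (leg (-1) +++ ((cross_section \<circ> p) +++ reversepath (leg (-1))))"
    and "leg (-1) +++ ((cross_section \<circ> p) +++ reversepath (leg (-1))) \<in> loops config_space x"
proof -
  show "splitting (path_class config_space p) =
      path_class config_space (leg (-1) +++ ((cross_section \<circ> p) +++ reversepath (leg (-1))))"
    unfolding splitting_def
    by (rule conjugate_map_path_class[where f = cross_section and x = x', OF _ leg_down assms]) (rule homotopic_paths_cross_section)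
  show "leg (-1) +++ ((cross_section \<circ> p) +++ reversepath (leg (-1))) \<in> loops config_space x"
    unfolding leg_start[of "-1", symmetric]
    by (rule conjugate_loop[where f = cross_section and x = x', OF _ leg_down assms]) (rule homotopic_paths_cross_section)
qed

text \<open>The downward leg moves only the third point, so it projects to a constant path, while
  the section projects back to \<open>p\<close>.\<close>

lemma p_star_splitting:
  assumes "A \<in> carrier (pure_braid_group x')"
  shows "p_star (splitting A) = A"
proof -
  obtain p where p: "p \<in> loops config_space x'" "A = path_class config_space p"
    using assms unfolding pure_braid_group_def by (rule fundamental_group_carrierE)
  have leg: "forget3 \<circ> leg (-1) = (\<lambda>_. x')"
    by (simp add: fun_eq_iff vec_eq_iff forall_2 leg_def braid_def base_points_component)
  then have "forget3 \<circ> reversepath (leg (-1)) = (\<lambda>_. x')"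
    by (simp add: fun_eq_iff reversepath_def)
  moreover have "forget3 \<circ> (cross_section \<circ> p) = p"
    by auto
  ultimately have "p_star (splitting A) = path_class config_space ((\<lambda>_. x') +++ (p +++ (\<lambda>_. x')))"
    using p splitting_path_class[OF p(1)] leg by (simp add: p_star_path_class path_compose_join)
  moreover have "homotopic_paths config_space ((\<lambda>_. x') +++ (p +++ (\<lambda>_. x'))) p"
  proof -
    note P = loopsD[OF p(1)]
    have "homotopic_paths config_space ((\<lambda>_. x') +++ (p +++ (\<lambda>_. x'))) (p +++ (\<lambda>_. x'))"
      using homotopic_paths_const_join[of "p +++ (\<lambda>_. x')" config_space] P
        loopsD[OF join_in_loops[OF p(1) const_in_loops[OF P(5)]]] by simp
    also have "homotopic_paths config_space \<dots> p"
      using homotopic_paths_join_const[of p config_space] P by simp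
    finally show ?thesis .
  qed
  ultimately show ?thesis
    using path_class_eqI p(2) by blast
qed

text \<open>With \<open>d\<close>, \<open>u\<close> the legs and \<open>s\<close> the section over
  the loop concerned, the products are \<open>d s u\<^sup>-\<^sup>1 u d\<^sup>-\<^sup>1\<close> and
  \<open>u d\<^sup>-\<^sup>1 d u\<^sup>-\<^sup>1 d s d\<^sup>-\<^sup>1\<close>. Both reduce to
  \<open>d s d\<^sup>-\<^sup>1\<close>, the value of the splitting.\<close>

lemma splitting_rho:
  "splitting (rho (forget3 a) 1) = rho a 1 \<otimes>\<^bsub>pure_braid_group x\<^esub> rho a 3"
  "splitting (rho (forget3 a) 2) = rho a 3 \<otimes>\<^bsub>pure_braid_group x\<^esub> rho a 2"
proof -
  let ?s = "\<lambda>i. cross_section \<circ> rho_path (forget3 a) i" and ?d = "leg (-1)" and ?u = "leg 1"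
  have d: "path ?d" "path_image ?d \<subseteq> config_space" "pathstart ?d = x" "pathfinish ?d = cross_section x'"
    and u: "path ?u" "path_image ?u \<subseteq> config_space" "pathstart ?u = x" "pathfinish ?u = cross_section x'"
    using leg_path leg_start leg_finish by auto
  have s: "path (?s i)" "path_image (?s i) \<subseteq> config_space" "pathstart (?s i) = cross_section x'"
      "pathfinish (?s i) = cross_section x'" if "i \<in> {1, 2}" for i
    by (rule compose_loop[where f = cross_section and x = x', OF _ leg_down rho_path_forget3_in_loops[OF that]],
        erule homotopic_paths_cross_section)+
  note ends = rho_path_ends[of a]
  have "homotopic_paths config_space (rho_path a 1 +++ rho_path a 3)
      ((?d +++ (?s 1 +++ reversepath ?u)) +++ (?u +++ reversepath ?d))"
    using ends by (intro homotopic_paths_join homotopic_rho_paths) auto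
  also have "homotopic_paths config_space \<dots> (?d +++ (?s 1 +++ reversepath ?d))"
    using d u s[of 1] by (intro homotopic_paths_cancel_middle) auto
  finally have h1: "homotopic_paths config_space (rho_path a 1 +++ rho_path a 3)
      (?d +++ (?s 1 +++ reversepath ?d))" .
  show "splitting (rho (forget3 a) 1) = rho a 1 \<otimes>\<^bsub>pure_braid_group x\<^esub> rho a 3"
    using path_class_eqI[OF h1] splitting_path_class(1)[OF rho_path_forget3_in_loops[of 1]]
    by (simp add: rho_eq pure_braid_group_def fundamental_group_mult rho_path_in_loops)
  have "homotopic_paths config_space (rho_path a 3 +++ rho_path a 2)
      ((?u +++ reversepath ?d) +++ ((?d +++ reversepath ?u) +++ (?d +++ (?s 2 +++ reversepath ?d))))"
    using ends by (intro homotopic_paths_join homotopic_rho_paths) auto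
  also have "homotopic_paths config_space \<dots> (?d +++ (?s 2 +++ reversepath ?d))"
    using d u s[of 2] by (intro homotopic_paths_cancel_outer) (auto simp: path_image_join)
  finally have h2: "homotopic_paths config_space (rho_path a 3 +++ rho_path a 2)
      (?d +++ (?s 2 +++ reversepath ?d))" .
  show "splitting (rho (forget3 a) 2) = rho a 3 \<otimes>\<^bsub>pure_braid_group x\<^esub> rho a 2"
    using path_class_eqI[OF h2] splitting_path_class(1)[OF rho_path_forget3_in_loops[of 2]]
    by (simp add: rho_eq pure_braid_group_def fundamental_group_mult rho_path_in_loops)
qed

lemma short_exact_fibration:
  "short_exact (fibre_group x) (pure_braid_group x) (pure_braid_group x') (fibre_inclusion_star x) p_star"
proof -
  let ?F = "UNIV - {x $ 1, x $ 2}"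
  have x3: "x $ 3 \<in> ?F"
    using base_points_in_config_space by (auto simp: config_space_3_iff)
  have i: "group_hom (fibre_group x) (pure_braid_group x) (fibre_inclusion_star x)"
    using induced_map_group_hom[OF continuous_on_add3 _ x3, of "forget3 x" config_space]
      add3_in_config_space[OF base_points_in_config_space]
    unfolding fibre_group_def pure_braid_group_def fibre_inclusion_star_def
    by (auto simp: image_subset_iff)
  have p: "group_hom (pure_braid_group x) (pure_braid_group x') p_star"
    using induced_map_group_hom[OF continuous_on_forget3 _ base_points_in_config_space, of config_space]
    unfolding pure_braid_group_def p_star_def base_points_forget3
    by (auto simp: image_subset_iff forget3_in_config_space)
  interpret i: group_hom "fibre_group x" "pure_braid_group x" "fibre_inclusion_star x"
    by (rule i)
  have one: "\<one>\<^bsub>pure_braid_group x\<^esub> = path_class config_space (\<lambda>_. x)"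
      "\<one>\<^bsub>pure_braid_group x'\<^esub> = path_class config_space (\<lambda>_. x')"
      "\<one>\<^bsub>fibre_group x\<^esub> = path_class ?F (\<lambda>_. x $ 3)"
    by (simp_all add: pure_braid_group_def fibre_group_def fundamental_group_one)
  have add3_loops: "add3 (forget3 x) \<circ> \<alpha> \<in> loops config_space x" if "\<alpha> \<in> loops ?F (x $ 3)" for \<alpha>
    using compose_in_loops[OF continuous_on_add3 _ that, of "forget3 x" config_space]
      add3_in_config_space[OF base_points_in_config_space] by (auto simp: image_subset_iff)
  have "inj_on (fibre_inclusion_star x) (carrier (fibre_group x))"
    unfolding i.inj_on_one_iff
  proof (intro allI impI)
    fix A assume A: "A \<in> carrier (fibre_group x)" "fibre_inclusion_star x A = \<one>\<^bsub>pure_braid_group x\<^esub>"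
    obtain \<alpha> where \<alpha>: "\<alpha> \<in> loops ?F (x $ 3)" "A = path_class ?F \<alpha>"
      using A(1) unfolding fibre_group_def by (rule fundamental_group_carrierE)
    then have "path_class config_space (add3 (forget3 x) \<circ> \<alpha>) = path_class config_space (\<lambda>_. x)"
      using A(2) by (simp add: fibre_inclusion_star_path_class one)
    then have "homotopic_paths config_space (add3 (forget3 x) \<circ> \<alpha>) (\<lambda>_. x)"
      using loopsD[OF add3_loops[OF \<alpha>(1)]] by (simp add: path_class_eq_iff)
    then show "A = \<one>\<^bsub>fibre_group x\<^esub>"
      using fibre_loop_null[OF \<alpha>(1)] \<alpha>(2) by (simp add: one path_class_eqI)
  qed
  moreover have "fibre_inclusion_star x ` carrier (fibre_group x) =
      kernel (pure_braid_group x) (pure_braid_group x') p_star"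
  proof (intro equalityI subsetI)
    fix B assume "B \<in> fibre_inclusion_star x ` carrier (fibre_group x)"
    then obtain \<alpha> where \<alpha>: "\<alpha> \<in> loops ?F (x $ 3)" "B = path_class config_space (add3 (forget3 x) \<circ> \<alpha>)"
      by (auto simp: fibre_group_def fundamental_group_carrier fibre_inclusion_star_path_class)
    have "forget3 \<circ> (add3 (forget3 x) \<circ> \<alpha>) = (\<lambda>_. x')"
      by (simp add: fun_eq_iff vec_eq_iff forall_2 base_points_forget3)
    then show "B \<in> kernel (pure_braid_group x) (pure_braid_group x') p_star"
      using \<alpha> add3_loops[OF \<alpha>(1)]
      by (auto simp: kernel_def p_star_path_class pure_braid_group_def fundamental_group_carrier
          fundamental_group_one)
  next
    fix B assume B: "B \<in> kernel (pure_braid_group x) (pure_braid_group x') p_star"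
    then obtain \<beta> where \<beta>: "\<beta> \<in> loops config_space x" "B = path_class config_space \<beta>"
      by (auto simp: kernel_def pure_braid_group_def fundamental_group_carrier)
    then have "path_class config_space (\<lambda>_. x') = path_class config_space (forget3 \<circ> \<beta>)"
      using B by (simp add: kernel_def one p_star_path_class)
    then have "homotopic_paths config_space (\<lambda>_. x') (forget3 \<circ> \<beta>)"
      using loopsD(1,2)[OF const_in_loops[OF base_points_in_config_space']]
      by (rule_tac path_class_eq_iff[THEN iffD1])
    then have "homotopic_paths config_space (forget3 \<circ> \<beta>) (\<lambda>_. forget3 x)"
      by (simp add: base_points_forget3 homotopic_paths_sym)
    then obtain \<alpha> where "\<alpha> \<in> loops ?F (x $ 3)" "homotopic_paths config_space \<beta> (add3 (forget3 x) \<circ> \<alpha>)"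
      using fibre_loop_of_kernel[OF \<beta>(1)] by blast
    then have "B = fibre_inclusion_star x (path_class ?F \<alpha>)" "path_class ?F \<alpha> \<in> carrier (fibre_group x)"
      using \<beta>(2) by (auto simp: fibre_inclusion_star_path_class path_class_eqI fibre_group_def fundamental_group_carrier)
    then show "B \<in> fibre_inclusion_star x ` carrier (fibre_group x)"
      by blast
  qed
  moreover have "p_star ` carrier (pure_braid_group x) = carrier (pure_braid_group x')"
  proof
    show "p_star ` carrier (pure_braid_group x) \<subseteq> carrier (pure_braid_group x')"
      using group_hom.hom_closed[OF p] by blast
    show "carrier (pure_braid_group x') \<subseteq> p_star ` carrier (pure_braid_group x)"
      \<comment> \<open>Surjectivity is read off from the splitting: each class is the image of its
        value under it.\<close>
      using p_star_splitting hom_in_carrier[OF splitting_hom] by (metis image_eqI subsetI)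
  qed
  ultimately show ?thesis
    using i p by (simp add: short_exact_def)
qed

end

theorem proposition10:
  fixes a :: "real^3"
  assumes "a $ 1 < a $ 2" and "a $ 2 < a $ 3"
  shows "short_exact (fibre_group (base_points a))
             (pure_braid_group (base_points a))
             (pure_braid_group (base_points (forget3 a)))
             (fibre_inclusion_star (base_points a)) p_star \<and>
         (\<exists>s \<in> hom (pure_braid_group (base_points (forget3 a))) (pure_braid_group (base_points a)).
             s (rho (forget3 a) 1) = rho a 1 \<otimes>\<^bsub>pure_braid_group (base_points a)\<^esub> rho a 3 \<and>
             s (rho (forget3 a) 2) = rho a 3 \<otimes>\<^bsub>pure_braid_group (base_points a)\<^esub> rho a 2 \<and>
             (\<forall>g \<in> carrier (pure_braid_group (base_points (forget3 a))). p_star (s g) = g))"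
  using short_exact_fibration[OF assms] splitting_hom[OF assms] splitting_rho[OF assms]
    p_star_splitting[OF assms] by blast

end
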